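(* Let $T>0$. Let $u(x,t)$ and $v(x,t)$ be, respectively, a supersolution and a subsolution in $Q_T$ of the problem $$u_t=\Delta u+c(x,t)u^p \ \ (x\in\Omega,\ t>0),\qquad \frac{\partial u(x,t)}{\partial\nu}=\int_\Omega k(x,y,t)u^l(y,t)\,dy\ \ (x\in\partial\Omega,\ t>0),\qquad u(x,0)=u_0(x)\ \ (x\in\Omega),$$ with $u(x,0)\ge v(x,0)$ in $\Omega$. If $\min(p,l)<1$, suppose in addition that $u(x,t)>0$ in $Q_T\cup\Gamma_T$ or $v(x,t)>0$ in $Q_T\cup\Gamma_T$. Then $u(x,t)\ge v(x,t)$ in $Q_T\cup\Gamma_T$.
   Context: Standing assumptions: $p>0$, $l>0$; $\Omega$ is a bounded domain in $\mathbb{R}^n$, $n\ge1$, with smooth boundary $\partial\Omega$, and $\nu$ is the unit outward normal on $\partial\Omega$; $c\in C^{\alpha}_{loc}(\overline\Omega\times[0,+\infty))$ for some $0<\alpha<1$ and $c(x,t)\ge0$; $k\in C(\partial\Omega\times\overline\Omega\times[0,+\infty))$ and $k(x,y,t)\ge0$; $u_0\in C^1(\overline\Omega)$, $u_0(x)\ge0$ in $\Omega$, and $\frac{\partial u_0(x)}{\partial\nu}=\int_\Omega k(x,y,0)u_0^l(y)\,dy$ on $\partial\Omega$. Notation: $Q_T=\Omega\times(0,T)$, $S_T=\partial\Omega\times(0,T)$, $\Gamma_T=S_T\cup\overline\Omega\times\{0\}$. Definition: a nonnegative function $u\in C^{2,1}(Q_T)\cap C^{1,0}(Q_T\cup\Gamma_T)$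 is a supersolution of the problem in $Q_T$ if $u_t\ge\Delta u+c(x,t)u^p$ for $(x,t)\in Q_T$, $\frac{\partial u(x,t)}{\partial\nu}\ge\int_\Omega k(x,y,t)u^l(y,t)\,dy$ for $(x,t)\in S_T$, and $u(x,0)\ge u_0(x)$ for $x\in\Omega$. A function $u\in C^{2,1}(Q_T)\cap C^{1,0}(Q_T\cup\Gamma_T)$ is a subsolution in $Q_T$ if $u\ge0$ and it satisfies these three inequalities in the reverse order. *)

theory Defs
  imports "HOL-Analysis.Analysis"
begin

section \<open>Domains with smooth boundary\<close>

text \<open>Derivatives along the standard basis are taken from the Frechet derivative; for continuously
  differentiable functions these are the usual partial derivatives.  The set \<open>U\<close> is meant to
  be open.\<close>

primrec Ck_on :: "nat \<Rightarrow> 'a::euclidean_space set \<Rightarrow> ('a \<Rightarrow> real) \<Rightarrow> bool" where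
  "Ck_on 0 U f \<longleftrightarrow> continuous_on U f"
| "Ck_on (Suc m) U f \<longleftrightarrow> (\<forall>x\<in>U. f differentiable (at x)) \<and>
     (\<forall>b\<in>Basis. Ck_on m U (\<lambda>x. frechet_derivative f (at x) b))"

definition Cinf_on :: "'a::euclidean_space set \<Rightarrow> ('a \<Rightarrow> real) \<Rightarrow> bool" where
  "Cinf_on U f \<longleftrightarrow> (\<forall>m. Ck_on m U f)"

definition grad :: "('a::euclidean_space \<Rightarrow> real) \<Rightarrow> 'a \<Rightarrow> 'a" where
  "grad f x = (\<Sum>b\<in>Basis. frechet_derivative f (at x) b *\<^sub>R b)"

text \<open>The domain is locally the negativity set of \<open>\<rho>\<close>, so it lies on one side of its
  boundary and \<open>grad \<rho>\<close> points outwards.  Since the gradient does not vanish, the boundary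
  inside \<open>U\<close> is exactly the smooth hypersurface \<open>\<rho> = 0\<close>.\<close>

definition local_defining_function ::
    "'a::euclidean_space set \<Rightarrow> 'a \<Rightarrow> 'a set \<Rightarrow> ('a \<Rightarrow> real) \<Rightarrow> bool" where
  "local_defining_function \<Omega> x U \<rho> \<longleftrightarrow>
     open U \<and> x \<in> U \<and> Cinf_on U \<rho> \<and> (\<forall>y\<in>U. grad \<rho> y \<noteq> 0) \<and>
     \<Omega> \<inter> U = {y \<in> U. \<rho> y < 0}"

definition smooth_bounded_domain :: "'a::euclidean_space set \<Rightarrow> bool" where
  "smooth_bounded_domain \<Omega> \<longleftrightarrow>
     open \<Omega> \<and> connected \<Omega> \<and> \<Omega> \<noteq> {} \<and> bounded \<Omega> \<and>
     (\<forall>x\<in>frontier \<Omega>. \<exists>U \<rho>. local_defining_function \<Omega> x U \<rho>)"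

definition outward_unit_normal :: "'a::euclidean_space set \<Rightarrow> 'a \<Rightarrow> 'a \<Rightarrow> bool" where
  "outward_unit_normal \<Omega> x n \<longleftrightarrow>
     (\<exists>U \<rho>. local_defining_function \<Omega> x U \<rho> \<and> n = grad \<rho> x /\<^sub>R norm (grad \<rho> x))"

section \<open>Function spaces\<close>

definition holder_loc_on :: "real \<Rightarrow> 'b::metric_space set \<Rightarrow> ('b \<Rightarrow> real) \<Rightarrow> bool" where
  "holder_loc_on \<alpha> A f \<longleftrightarrow>
     (\<forall>K. compact K \<and> K \<subseteq> A \<longrightarrow>
        (\<exists>C. \<forall>z\<in>K. \<forall>w\<in>K. \<bar>f z - f w\<bar> \<le> C * dist z w powr \<alpha>))"

text \<open>Up to the boundary, the derivative is the one relative to \<open>closure \<Omega>\<close>.  If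
  \<open>\<Omega>\<close> has smooth boundary, this derivative is unique also at boundary points, and it is
  the continuous extension of the gradient from \<open>\<Omega>\<close>.\<close>

definition dir_deriv ::
    "'a::euclidean_space set \<Rightarrow> ('a \<Rightarrow> real) \<Rightarrow> 'a \<Rightarrow> 'a \<Rightarrow> real" where
  "dir_deriv \<Omega> f h x = frechet_derivative f (at x within closure \<Omega>) h"

definition C1_closure :: "'a::euclidean_space set \<Rightarrow> ('a \<Rightarrow> real) \<Rightarrow> bool" where
  "C1_closure \<Omega> f \<longleftrightarrow>
     (\<forall>x\<in>closure \<Omega>. f differentiable (at x within closure \<Omega>)) \<and>
     (\<forall>b\<in>Basis. continuous_on (closure \<Omega>) (dir_deriv \<Omega> f b))"

definition cylinder :: "'a::euclidean_space set \<Rightarrow> real \<Rightarrow> ('a \<times> real) set" where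
  "cylinder \<Omega> T = \<Omega> \<times> {0<..<T}"

definition lateral_boundary :: "'a::euclidean_space set \<Rightarrow> real \<Rightarrow> ('a \<times> real) set" where
  "lateral_boundary \<Omega> T = frontier \<Omega> \<times> {0<..<T}"

definition parabolic_boundary :: "'a::euclidean_space set \<Rightarrow> real \<Rightarrow> ('a \<times> real) set" where
  "parabolic_boundary \<Omega> T = lateral_boundary \<Omega> T \<union> closure \<Omega> \<times> {0}"

definition space_deriv ::
    "'a::euclidean_space \<Rightarrow> ('a \<Rightarrow> real \<Rightarrow> real) \<Rightarrow> 'a \<Rightarrow> real \<Rightarrow> real" where
  "space_deriv b u x t = frechet_derivative (\<lambda>y. u y t) (at x) b"

definition time_deriv :: "('a::euclidean_space \<Rightarrow> real \<Rightarrow> real) \<Rightarrow> 'a \<Rightarrow> real \<Rightarrow> real" where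
  "time_deriv u x t = deriv (u x) t"

definition laplacian :: "('a::euclidean_space \<Rightarrow> real \<Rightarrow> real) \<Rightarrow> 'a \<Rightarrow> real \<Rightarrow> real" where
  "laplacian u x t = (\<Sum>b\<in>Basis. space_deriv b (space_deriv b u) x t)"

text \<open>Two continuous space derivatives and one continuous time derivative in the open cylinder.\<close>

definition C21 :: "'a::euclidean_space set \<Rightarrow> real \<Rightarrow> ('a \<Rightarrow> real \<Rightarrow> real) \<Rightarrow> bool" where
  "C21 \<Omega> T u \<longleftrightarrow>
     continuous_on (cylinder \<Omega> T) (\<lambda>(x, t). u x t) \<and>
     (\<forall>(x, t)\<in>cylinder \<Omega> T. u x differentiable (at t)) \<and>
     continuous_on (cylinder \<Omega> T) (\<lambda>(x, t). time_deriv u x t) \<and>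
     (\<forall>(x, t)\<in>cylinder \<Omega> T. (\<lambda>y. u y t) differentiable (at x)) \<and>
     (\<forall>b\<in>Basis. continuous_on (cylinder \<Omega> T) (\<lambda>(x, t). space_deriv b u x t)) \<and>
     (\<forall>b\<in>Basis. \<forall>(x, t)\<in>cylinder \<Omega> T. (\<lambda>y. space_deriv b u y t) differentiable (at x)) \<and>
     (\<forall>b\<in>Basis. \<forall>b'\<in>Basis.
        continuous_on (cylinder \<Omega> T) (\<lambda>(x, t). space_deriv b' (space_deriv b u) x t))"

text \<open>One continuous space derivative, up to the parabolic boundary.\<close>

definition C10 :: "'a::euclidean_space set \<Rightarrow> real \<Rightarrow> ('a \<Rightarrow> real \<Rightarrow> real) \<Rightarrow> bool" where
  "C10 \<Omega> T u \<longleftrightarrow>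
     (let D = cylinder \<Omega> T \<union> parabolic_boundary \<Omega> T in
       continuous_on D (\<lambda>(x, t). u x t) \<and>
       (\<forall>(x, t)\<in>D. (\<lambda>y. u y t) differentiable (at x within closure \<Omega>)) \<and>
       (\<forall>b\<in>Basis. continuous_on D (\<lambda>(x, t). dir_deriv \<Omega> (\<lambda>y. u y t) b x)))"

section \<open>Supersolutions and subsolutions\<close>

text \<open>The functions \<open>u\<close> below are nonnegative and the exponents positive, so \<open>powr\<close>
  is the ordinary power, with \<open>0 powr p = 0\<close>.\<close>

definition supersolution ::
    "'a::euclidean_space set \<Rightarrow> ('a \<Rightarrow> 'a) \<Rightarrow> ('a \<Rightarrow> real \<Rightarrow> real) \<Rightarrow>
     ('a \<Rightarrow> 'a \<Rightarrow> real \<Rightarrow> real) \<Rightarrow> real \<Rightarrow> real \<Rightarrow> ('a \<Rightarrow> real) \<Rightarrow> real \<Rightarrow>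
     ('a \<Rightarrow> real \<Rightarrow> real) \<Rightarrow> bool" where
  "supersolution \<Omega> \<nu> c k p l u0 T u \<longleftrightarrow>
     C21 \<Omega> T u \<and> C10 \<Omega> T u \<and>
     (\<forall>(x, t)\<in>cylinder \<Omega> T \<union> parabolic_boundary \<Omega> T. u x t \<ge> 0) \<and>
     (\<forall>(x, t)\<in>cylinder \<Omega> T. time_deriv u x t \<ge> laplacian u x t + c x t * u x t powr p) \<and>
     (\<forall>(x, t)\<in>lateral_boundary \<Omega> T.
        dir_deriv \<Omega> (\<lambda>y. u y t) (\<nu> x) x \<ge> (LINT y:\<Omega>|lborel. k x y t * u y t powr l)) \<and>
     (\<forall>x\<in>\<Omega>. u x 0 \<ge> u0 x)"

definition subsolution ::
    "'a::euclidean_space set \<Rightarrow> ('a \<Rightarrow> 'a) \<Rightarrow> ('a \<Rightarrow> real \<Rightarrow> real) \<Rightarrow>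
     ('a \<Rightarrow> 'a \<Rightarrow> real \<Rightarrow> real) \<Rightarrow> real \<Rightarrow> real \<Rightarrow> ('a \<Rightarrow> real) \<Rightarrow> real \<Rightarrow>
     ('a \<Rightarrow> real \<Rightarrow> real) \<Rightarrow> bool" where
  "subsolution \<Omega> \<nu> c k p l u0 T u \<longleftrightarrow>
     C21 \<Omega> T u \<and> C10 \<Omega> T u \<and>
     (\<forall>(x, t)\<in>cylinder \<Omega> T \<union> parabolic_boundary \<Omega> T. u x t \<ge> 0) \<and>
     (\<forall>(x, t)\<in>cylinder \<Omega> T. time_deriv u x t \<le> laplacian u x t + c x t * u x t powr p) \<and>
     (\<forall>(x, t)\<in>lateral_boundary \<Omega> T.
        dir_deriv \<Omega> (\<lambda>y. u y t) (\<nu> x) x \<le> (LINT y:\<Omega>|lborel. k x y t * u y t powr l)) \<and>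
     (\<forall>x\<in>\<Omega>. u x 0 \<le> u0 x)"

end

theory Submission
  imports Defs
begin

text \<open>The difference \<open>w = v - u\<close> of the subsolution and the supersolution satisfies a linear problem.
  If \<open>0 \<le> a \<le> b\<close> and \<open>b > 0\<close>, then \<open>b powr q - a powr q\<close> is at most a constant times
  \<open>b powr (q - 1) * (b - a)\<close>.  On a closed cylinder that ends before time \<open>T\<close> the functions are
  bounded, and if the exponent is below \<open>1\<close> the positivity of \<open>u\<close> or of \<open>v\<close> keeps the larger of two ordered
  values away from zero.  So both nonlinearities are one-sided Lipschitz
  (\<open>powr_one_sided_Lipschitz_on_compact\<close>), and \<open>w\<close> satisfies \<open>w\<^sub>t \<le> \<Delta>w + C w\<^sup>+\<close> in the
  cylinder while its normal derivative at a boundary point is at most a constant \<open>A\<close> times any nonnegative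
  upper bound of \<open>w\<close> at the same time.

  That these conditions and \<open>w \<le> 0\<close> at time \<open>0\<close> force \<open>w \<le> 0\<close> is
  \<open>nonlocal_flux_maximum_principle\<close>.  The nonlocal term has no sign that a maximum principle could use
  directly, and it need not be small.  It is beaten by a barrier \<open>\<phi>\<close>
  with \<open>0 < \<phi> \<le> 1\<close> on the closed domain and normal derivative larger than \<open>A\<close>: compared with
  \<open>exp (\<mu> * t) * \<phi> x\<close> for large \<open>\<mu>\<close>, the function \<open>w\<close> has no positive maximal quotient, neither on the boundary nor
  inside.  The barrier (\<open>barrier_function\<close>) is \<open>exp (N * g)\<close> with a large \<open>N\<close>, where \<open>g\<close> is a global
  defining function of the domain glued together from local ones
  (\<open>smooth_bounded_domain_global_defining_function\<close>).\<close>

section \<open>Calculus of continuously differentiable functions\<close>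

text \<open>The recursive equation is kept out of the simplifier so that \<open>Ck_on\<close> hypotheses stay folded
  and match the closure rules below.\<close>

declare Ck_on.simps(2) [simp del]

text \<open>Openness of \<open>U\<close> is essential: derivatives at a point of \<open>U\<close> see only nearby values.\<close>

lemma Ck_on_cong:
  assumes "open U" "\<And>x. x \<in> U \<Longrightarrow> f x = g x" "Ck_on m U f"
  shows "Ck_on m U g"
  using assms(2,3)
proof (induction m arbitrary: f g)
  case 0
  then show ?case by (simp cong: continuous_on_cong)
next
  case (Suc m)
  have der: "(g has_derivative frechet_derivative f (at x)) (at x)" if "x \<in> U" for x
  proof (rule has_derivative_transform_within_open[OF _ \<open>open U\<close> that])
    show "(f has_derivative frechet_derivative f (at x)) (at x)"
      using Suc.prems that by (simp add: frechet_derivative_works Ck_on.simps(2))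
  qed (use Suc.prems in auto)
  have "Ck_on m U (\<lambda>x. frechet_derivative g (at x) b)" if "b \<in> Basis" for b
  proof (rule Suc.IH)
    show "Ck_on m U (\<lambda>x. frechet_derivative f (at x) b)"
      using Suc.prems that by (simp add: Ck_on.simps(2))
    show "frechet_derivative f (at x) b = frechet_derivative g (at x) b" if "x \<in> U" for x
      using frechet_derivative_at[OF der[OF that]] by simp
  qed
  then show ?case using der by (auto simp: differentiable_def Ck_on.simps(2))
qed

text \<open>In the definition the derivative is a Hilbert choice.  This rule replaces it by any explicitly
  given derivative, and all closure properties are inductions through it.\<close>

lemma Ck_on_SucI:
  assumes "open U" "\<And>x. x \<in> U \<Longrightarrow> (f has_derivative f' x) (at x)"
    and "\<And>b. b \<in> Basis \<Longrightarrow> Ck_on m U (\<lambda>x. f' x b)"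
  shows "Ck_on (Suc m) U f"
proof -
  have "Ck_on m U (\<lambda>x. frechet_derivative f (at x) b)" if "b \<in> Basis" for b
    by (rule Ck_on_cong[OF \<open>open U\<close> _ assms(3)[OF that]])
       (simp add: frechet_derivative_at[OF assms(2), symmetric])
  then show ?thesis using assms(2) by (auto simp: differentiable_def Ck_on.simps(2))
qed

lemma Ck_on_Suc_has_derivative:
  "Ck_on (Suc m) U f \<Longrightarrow> x \<in> U \<Longrightarrow> (f has_derivative frechet_derivative f (at x)) (at x)"
  by (simp add: frechet_derivative_works Ck_on.simps(2))

lemma Ck_on_frechet_derivative:
  "Ck_on (Suc m) U f \<Longrightarrow> b \<in> Basis \<Longrightarrow> Ck_on m U (\<lambda>x. frechet_derivative f (at x) b)"
  by (simp add: Ck_on.simps(2))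

lemma Ck_on_SucD: "Ck_on (Suc m) U f \<Longrightarrow> Ck_on m U f"
proof (induction m arbitrary: f)
  case 0
  then show ?case
    by (metis Ck_on.simps continuous_at_imp_continuous_on differentiable_imp_continuous_within)
next
  case (Suc m)
  then show ?case by (metis Ck_on.simps(2))
qed

lemma Ck_on_imp_continuous_on: "Ck_on m U f \<Longrightarrow> continuous_on U f"
  by (induction m) (use Ck_on.simps(1) Ck_on_SucD in blast)+

lemma Ck_on_const: "open U \<Longrightarrow> Ck_on m U (\<lambda>x. a)"
proof (induction m arbitrary: a)
  case (Suc m)
  show ?case
    by (rule Ck_on_SucI[where f' = "\<lambda>x h. 0"]) (use Suc in auto)
qed auto

lemma Ck_on_add: "open U \<Longrightarrow> Ck_on m U f \<Longrightarrow> Ck_on m U g \<Longrightarrow> Ck_on m U (\<lambda>x. f x + g x)"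
proof (induction m arbitrary: f g)
  case (Suc m)
  show ?case
    by (rule Ck_on_SucI[OF \<open>open U\<close> has_derivative_add[OF Ck_on_Suc_has_derivative[OF Suc.prems(2)]
          Ck_on_Suc_has_derivative[OF Suc.prems(3)]]])
       (use Suc in \<open>auto intro: Ck_on_frechet_derivative\<close>)
qed (auto intro!: continuous_intros)

lemma Ck_on_mult: "open U \<Longrightarrow> Ck_on m U f \<Longrightarrow> Ck_on m U g \<Longrightarrow> Ck_on m U (\<lambda>x. f x * g x)"
proof (induction m arbitrary: f g)
  case (Suc m)
  let ?f = "\<lambda>x. frechet_derivative f (at x)" and ?g = "\<lambda>x. frechet_derivative g (at x)"
  show ?case
  proof (rule Ck_on_SucI[OF \<open>open U\<close>])
    show "((\<lambda>x. f x * g x) has_derivative (\<lambda>h. f x * ?g x h + ?f x h * g x)) (at x)"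
      if "x \<in> U" for x
      by (intro has_derivative_mult Ck_on_Suc_has_derivative[OF _ that]) (fact Suc.prems)+
    show "Ck_on m U (\<lambda>x. f x * ?g x b + ?f x b * g x)" if "b \<in> Basis" for b
      using Suc.prems that by (intro Ck_on_add Suc.IH) (auto dest: Ck_on_SucD Ck_on_frechet_derivative)
  qed
qed (auto intro!: continuous_intros)

lemma Ck_on_sum:
  "open U \<Longrightarrow> (\<And>i. i \<in> I \<Longrightarrow> Ck_on m U (f i)) \<Longrightarrow> Ck_on m U (\<lambda>x. \<Sum>i\<in>I. f i x)"
  by (induction I rule: infinite_finite_induct) (auto intro: Ck_on_add Ck_on_const)

lemma Ck_on_exp: "open U \<Longrightarrow> Ck_on m U f \<Longrightarrow> Ck_on m U (\<lambda>x. exp (f x))"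
proof (induction m arbitrary: f)
  case (Suc m)
  let ?f = "\<lambda>x. frechet_derivative f (at x)"
  show ?case
  proof (rule Ck_on_SucI[OF \<open>open U\<close>])
    show "((\<lambda>x. exp (f x)) has_derivative (\<lambda>h. exp (f x) * ?f x h)) (at x)" if "x \<in> U" for x
      using Ck_on_Suc_has_derivative[OF Suc.prems(2) that] by (auto intro!: derivative_eq_intros)
    show "Ck_on m U (\<lambda>x. exp (f x) * ?f x b)" if "b \<in> Basis" for b
      using Suc.prems that by (intro Ck_on_mult Suc.IH) (auto dest: Ck_on_SucD Ck_on_frechet_derivative)
  qed
qed (auto intro!: continuous_intros)

text \<open>At the origin \<open>max 0 y ^ (n + 2) = max 0 y ^ (n + 1) * y\<close>, which is a Caratheodory
  factorization with a continuous first factor.\<close>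

lemma has_real_derivative_max_0_power:
  "((\<lambda>y::real. max 0 y ^ Suc (Suc n)) has_real_derivative real (Suc (Suc n)) * max 0 x ^ Suc n) (at x)"
proof -
  consider "x > 0" | "x < 0" | "x = 0" by linarith
  then show ?thesis
  proof cases
    case 1
    have "((\<lambda>y::real. y ^ Suc (Suc n)) has_real_derivative real (Suc (Suc n)) * max 0 x ^ Suc n) (at x)"
      using DERIV_pow[of "Suc (Suc n)" x] 1 by (simp add: max_def)
    then show ?thesis
      by (rule has_field_derivative_transform_within_open[where S = "{0<..}"]) (use 1 in auto)
  next
    case 2
    have "((\<lambda>y::real. 0) has_real_derivative real (Suc (Suc n)) * max 0 x ^ Suc n) (at x)"
      using 2 by (auto intro!: derivative_eq_intros simp: max_def)
    then show ?thesis
      by (rule has_field_derivative_transform_within_open[where S = "{..<0}"]) (use 2 in auto)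
  next
    case 3
    have "isCont (\<lambda>y::real. max 0 y ^ Suc n) x"
      by (intro continuous_intros)
    moreover have "max 0 z ^ Suc (Suc n) - max 0 x ^ Suc (Suc n) = max 0 z ^ Suc n * (z - x)" for z
      using 3 by (auto simp: max_def)
    ultimately show ?thesis
      using 3 by (intro CARAT_DERIV[THEN iffD2] exI[of _ "\<lambda>y. max 0 y ^ Suc n"]) auto
  qed
qed

text \<open>The source of bump functions: with \<open>q y = r\<^sup>2 - \<bar>y - x\<bar>\<^sup>2\<close> this is a function of class
  \<open>C\<^sup>m\<close>, positive on a ball and zero outside.\<close>

lemma Ck_on_max_0_power:
  "open U \<Longrightarrow> Ck_on m U q \<Longrightarrow> Ck_on m U (\<lambda>x. max 0 (q x) ^ Suc m)"
proof (induction m arbitrary: q)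
  case 0
  then show ?case by (auto intro!: continuous_intros)
next
  case (Suc m)
  let ?q = "\<lambda>x. frechet_derivative q (at x)"
  show ?case
  proof (rule Ck_on_SucI[OF \<open>open U\<close>])
    show "((\<lambda>x. max 0 (q x) ^ Suc (Suc m)) has_derivative
        (\<lambda>h. (real (Suc (Suc m)) * max 0 (q x) ^ Suc m) * ?q x h)) (at x)" if "x \<in> U" for x
      using has_derivative_compose[OF Ck_on_Suc_has_derivative[OF Suc.prems(2) that]
          has_real_derivative_max_0_power[of m, unfolded has_field_derivative_def]]
      by simp
    show "Ck_on m U (\<lambda>x. (real (Suc (Suc m)) * max 0 (q x) ^ Suc m) * ?q x b)"
      if "b \<in> Basis" for b
      using Suc.prems that by (intro Ck_on_mult Suc.IH Ck_on_const) (auto dest: Ck_on_SucD Ck_on_frechet_derivative)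
  qed
qed

lemma Ck_on_inner: "open U \<Longrightarrow> Ck_on m U (\<lambda>x. (x - a) \<bullet> b)"
proof (cases m)
  case (Suc n)
  assume "open U"
  then show ?thesis
    unfolding Suc by (intro Ck_on_SucI[where f' = "\<lambda>x h. h \<bullet> b"] Ck_on_const)
       (auto intro!: derivative_eq_intros)
qed (auto intro!: continuous_intros)

lemma Ck_on_dist_squared: "open U \<Longrightarrow> Ck_on m U (\<lambda>x. r - (x - a) \<bullet> (x - a))"
proof (cases m)
  case (Suc n)
  assume "open U"
  then show ?thesis
    unfolding Suc
    by (intro Ck_on_SucI[where f' = "\<lambda>x h. (- 2) * ((x - a) \<bullet> h)"] Ck_on_const Ck_on_mult Ck_on_inner)
       (auto intro!: derivative_eq_intros simp: inner_commute)
qed (auto intro!: continuous_intros)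

lemma Ck_on_Un:
  assumes "open U" "open V" "Ck_on m U f" "Ck_on m V f"
  shows "Ck_on m (U \<union> V) f"
  using assms(3,4)
proof (induction m arbitrary: f)
  case 0
  then show ?case using assms by (simp add: continuous_on_open_Un)
qed (simp add: Ck_on.simps(2) ball_Un)

lemma frechet_derivative_eq_grad:
  assumes "f differentiable (at x)"
  shows "frechet_derivative f (at x) h = grad f x \<bullet> h"
proof -
  interpret linear "frechet_derivative f (at x)"
    using assms by (simp add: linear_frechet_derivative)
  have "frechet_derivative f (at x) (\<Sum>b\<in>Basis. (h \<bullet> b) *\<^sub>R b) = grad f x \<bullet> h"
    by (simp only: sum scale grad_def inner_sum_left inner_scaleR_left)
       (simp add: inner_commute mult.commute)
  then show ?thesis by (simp add: euclidean_representation)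
qed

lemma has_derivative_grad: "f differentiable (at x) \<Longrightarrow> (f has_derivative (\<lambda>h. grad f x \<bullet> h)) (at x)"
  using frechet_derivative_works frechet_derivative_eq_grad
  by (metis (no_types, lifting) ext)

section \<open>Defining functions and the outward normal\<close>

lemma local_defining_function_differentiable:
  "local_defining_function \<Omega> x U \<rho> \<Longrightarrow> y \<in> U \<Longrightarrow> \<rho> differentiable (at y)"
  unfolding local_defining_function_def Cinf_on_def
  by (metis Ck_on.simps(2))

text \<open>A frontier point is not in the open set \<open>\<Omega>\<close>, so \<open>\<rho>\<close> is not negative there; if it were positive, it
  would be positive on a neighbourhood, which would then miss \<open>\<Omega>\<close>.\<close>

lemma local_defining_function_frontier:
  assumes "local_defining_function \<Omega> x U \<rho>" "open \<Omega>" "y \<in> frontier \<Omega>" "y \<in> U"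
  shows "\<rho> y = 0"
proof (rule antisym)
  have U: "open U" "\<Omega> \<inter> U = {y \<in> U. \<rho> y < 0}"
    using assms(1) by (auto simp: local_defining_function_def)
  have "y \<notin> \<Omega>"
    using assms by (simp add: frontier_def interior_open)
  then show "0 \<le> \<rho> y" using U assms(4) by force
  show "\<rho> y \<le> 0"
  proof (rule ccontr)
    assume "\<not> \<rho> y \<le> 0"
    moreover have "continuous (at y) \<rho>"
      using local_defining_function_differentiable[OF assms(1,4)]
      by (rule differentiable_imp_continuous_within)
    ultimately have "eventually (\<lambda>z. \<rho> z > 0) (nhds y)"
      using order_tendstoD(1)[of \<rho> "\<rho> y" "nhds y" 0]
      by (simp add: continuous_at tendsto_nhds_iff)
    then have "eventually (\<lambda>z. z \<in> U \<and> \<rho> z > 0) (nhds y)"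
      using eventually_nhds_in_open[OF U(1) assms(4)] by eventually_elim auto
    then obtain V where "open V" "y \<in> V" "\<forall>z\<in>V. z \<in> U \<and> \<rho> z > 0"
      by (auto simp: eventually_nhds)
    moreover have "y \<in> closure \<Omega>" using assms(3) by (simp add: frontier_def)
    ultimately obtain z where "z \<in> V" "z \<in> \<Omega>"
      by (metis closure_iff_nhds_not_empty disjoint_iff order_refl)
    then show False using U \<open>\<forall>z\<in>V. z \<in> U \<and> \<rho> z > 0\<close> by force
  qed
qed

lemma has_real_derivative_along_ray:
  fixes f :: "'a::euclidean_space \<Rightarrow> real"
  assumes "(f has_derivative D) (at x within S)" "\<And>s. s \<in> J \<Longrightarrow> x + s *\<^sub>R h \<in> S"
  shows "((\<lambda>s. f (x + s *\<^sub>R h)) has_real_derivative D h) (at 0 within J)"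
proof -
  have "((\<lambda>s. x + s *\<^sub>R h) has_derivative (\<lambda>s. s *\<^sub>R h)) (at 0 within J)"
    by (auto intro!: derivative_eq_intros)
  moreover have "(f has_derivative D) (at (x + 0 *\<^sub>R h) within (\<lambda>s. x + s *\<^sub>R h) ` J)"
    using assms by (auto intro: has_derivative_subset)
  ultimately have "((\<lambda>s. f (x + s *\<^sub>R h)) has_derivative (\<lambda>s. D (s *\<^sub>R h))) (at 0 within J)"
    by (rule has_derivative_in_compose)
  moreover have "D (s *\<^sub>R h) = s * D h" for s
    using linear_cmul[OF has_derivative_linear[OF assms(1)]] by simp
  ultimately show ?thesis
    by (simp add: has_field_derivative_def mult_commute_abs)
qed

text \<open>Along such a direction a local defining function decreases strictly from \<open>0\<close>.\<close>

lemma inward_direction: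
  assumes "outward_unit_normal \<Omega> x n" "open \<Omega>" "x \<in> frontier \<Omega>" "n \<bullet> h < 0"
  obtains d where "d > 0" "\<And>s. 0 < s \<Longrightarrow> s < d \<Longrightarrow> x + s *\<^sub>R h \<in> \<Omega>"
proof -
  obtain U \<rho> where \<rho>: "local_defining_function \<Omega> x U \<rho>" and n: "n = grad \<rho> x /\<^sub>R norm (grad \<rho> x)"
    using assms(1) by (auto simp: outward_unit_normal_def)
  then have U: "open U" "x \<in> U" "\<Omega> \<inter> U = {y \<in> U. \<rho> y < 0}" "grad \<rho> x \<noteq> 0"
    by (auto simp: local_defining_function_def)
  have neg: "grad \<rho> x \<bullet> h < 0"
    using assms(4) U(4) by (simp add: n mult_less_0_iff)
  have "((\<lambda>s. \<rho> (x + s *\<^sub>R h)) has_real_derivative grad \<rho> x \<bullet> h) (at 0)"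
    using has_real_derivative_along_ray[OF has_derivative_grad, of \<rho> x UNIV h]
      local_defining_function_differentiable[OF \<rho> U(2)] by simp
  from DERIV_neg_dec_right[OF this neg]
  obtain d1 where d1: "d1 > 0" "\<And>s. 0 < s \<Longrightarrow> s < d1 \<Longrightarrow> \<rho> (x + s *\<^sub>R h) < \<rho> x"
    by auto
  have "((\<lambda>s. x + s *\<^sub>R h) \<longlongrightarrow> x + 0 *\<^sub>R h) (at_right 0)"
    by (intro tendsto_intros)
  then have "eventually (\<lambda>s. x + s *\<^sub>R h \<in> U) (at_right 0)"
    using U by (intro topological_tendstoD) auto
  then obtain d2 where d2: "d2 > 0" "\<And>s. 0 < s \<Longrightarrow> s < d2 \<Longrightarrow> x + s *\<^sub>R h \<in> U"
    by (auto simp: eventually_at_right_field)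
  show thesis
  proof
    show "min d1 d2 > 0" using d1 d2 by simp
    show "x + s *\<^sub>R h \<in> \<Omega>" if "0 < s" "s < min d1 d2" for s
      using d1(2)[of s] d2(2)[of s] that U(3)
        local_defining_function_frontier[OF \<rho> assms(2,3) U(2)] by force
  qed
qed

text \<open>A one-sided first order condition at a maximum.  The set \<open>S\<close> may have \<open>x\<close> on its boundary, and
  any derivative relative to \<open>S\<close> will do, unique or not.\<close>

lemma has_derivative_nonpos_along_inward_ray:
  fixes f :: "'a::euclidean_space \<Rightarrow> real"
  assumes "(f has_derivative D) (at x within S)" "d > 0"
    and "\<And>s. 0 < s \<Longrightarrow> s < d \<Longrightarrow> x + s *\<^sub>R h \<in> S \<and> f (x + s *\<^sub>R h) \<le> f x"
    and "x \<in> S"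
  shows "D h \<le> 0"
proof (rule ccontr)
  assume "\<not> D h \<le> 0"
  have *: "((\<lambda>s. f (x + s *\<^sub>R h)) has_real_derivative D h) (at 0 within {0..<d})"
    by (rule has_real_derivative_along_ray[OF assms(1)])
       (use assms(3,4) in \<open>auto simp: le_less\<close>)
  obtain e where e: "e > 0" "\<And>s. 0 < s \<Longrightarrow> s \<in> {0..<d} \<Longrightarrow> s < e \<Longrightarrow> f x < f (x + s *\<^sub>R h)"
    using has_real_derivative_pos_inc_right[OF *] \<open>\<not> D h \<le> 0\<close> by auto
  have "0 < min d e / 2" "min d e / 2 < d" "min d e / 2 < e" using assms(2) e(1) by auto
  then show False using e(2)[of "min d e / 2"] assms(3)[of "min d e / 2"] by fastforce
qed

lemma norm_outward_unit_normal: "outward_unit_normal \<Omega> x n \<Longrightarrow> norm n = 1"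
  by (auto simp: outward_unit_normal_def local_defining_function_def)

text \<open>At a boundary point where \<open>f\<close> attains its maximum over nearby points of \<open>\<Omega>\<close>, the gradient of \<open>f\<close>
  has nonpositive product with the whole open half space of inward directions, hence is a
  nonnegative multiple of the outward normal.  This shows in particular that all local defining
  functions determine the same normal, and it turns the normal derivative into the length of the
  gradient, which has a positive minimum on a compact boundary if the gradient is continuous and does
  not vanish there.\<close>

lemma grad_inner_normal_eq_norm:
  assumes n: "outward_unit_normal \<Omega> x n" and "open \<Omega>" "x \<in> frontier \<Omega>"
    and f: "f differentiable (at x)" and V: "open V" "x \<in> V" "\<And>y. y \<in> \<Omega> \<inter> V \<Longrightarrow> f y \<le> f x"
  shows "grad f x \<bullet> n = norm (grad f x)"
proof -
  let ?a = "grad f x"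
  have nn: "n \<bullet> n = 1" using norm_outward_unit_normal[OF n] by (simp add: dot_square_norm)
  have half: "?a \<bullet> h \<le> 0" if nh: "n \<bullet> h < 0" for h
  proof -
    obtain d1 where d1: "d1 > 0" "\<And>s. 0 < s \<Longrightarrow> s < d1 \<Longrightarrow> x + s *\<^sub>R h \<in> \<Omega>"
      by (rule inward_direction[OF n assms(2,3) nh]) auto
    have "((\<lambda>s. x + s *\<^sub>R h) \<longlongrightarrow> x + 0 *\<^sub>R h) (at_right 0)"
      by (intro tendsto_intros)
    then have "eventually (\<lambda>s. x + s *\<^sub>R h \<in> V) (at_right 0)"
      using V by (intro topological_tendstoD) auto
    then obtain d2 where d2: "d2 > 0" "\<And>s. 0 < s \<Longrightarrow> s < d2 \<Longrightarrow> x + s *\<^sub>R h \<in> V"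
      by (auto simp: eventually_at_right_field)
    show ?thesis
      by (rule has_derivative_nonpos_along_inward_ray[OF has_derivative_grad[OF f], where d = "min d1 d2"])
         (use d1 d2 V(3) in auto)
  qed
  define q where "q = ?a \<bullet> n"
  have q0: "q \<ge> 0" using half[of "- n"] nn by (simp add: q_def)
  \<comment> \<open>Test with the tangential part of the gradient, tilted inwards by a small \<open>\<delta>\<close>.\<close>
  have "?a \<bullet> ?a \<le> q\<^sup>2"
  proof (rule field_le_epsilon)
    fix e :: real assume "e > 0"
    define \<delta> where "\<delta> = e / (q + 1)"
    have \<delta>: "\<delta> > 0" "\<delta> * q \<le> e" using \<open>e > 0\<close> q0 by (auto simp: \<delta>_def field_simps)
    have "n \<bullet> (?a - (q + \<delta>) *\<^sub>R n) < 0"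
      using \<delta> by (simp add: inner_diff_right nn q_def inner_commute)
    from half[OF this] have "?a \<bullet> ?a - (q + \<delta>) * q \<le> 0"
      by (simp add: inner_diff_right q_def)
    then show "?a \<bullet> ?a \<le> q\<^sup>2 + e" using \<delta> by (simp add: algebra_simps power2_eq_square)
  qed
  then have "norm ?a \<le> q" using q0 by (simp add: dot_square_norm power2_le_iff_abs_le)
  moreover have "q \<le> norm ?a"
    using norm_cauchy_schwarz[of ?a n] norm_outward_unit_normal[OF n] by (simp add: q_def)
  ultimately show ?thesis by (simp add: q_def)
qed

section \<open>A barrier with steep normal derivative\<close>

text \<open>Finitely many local defining functions, each multiplied by a bump supported in its neighbourhood,
  are added up.  On the boundary the summands vanish and their gradients are nonnegative multiples of
  the same outward normal, so they cannot cancel.\<close>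

lemma smooth_bounded_domain_global_defining_function:
  assumes "smooth_bounded_domain \<Omega>"
  obtains g where "Ck_on 2 UNIV g" "\<And>x. x \<in> closure \<Omega> \<Longrightarrow> g x \<le> 0"
    "\<And>x. x \<in> frontier \<Omega> \<Longrightarrow> g x = 0" "\<And>x. x \<in> frontier \<Omega> \<Longrightarrow> grad g x \<noteq> 0"
proof -
  have \<Omega>: "open \<Omega>" "bounded \<Omega>"
    using assms by (auto simp: smooth_bounded_domain_def)
  have "\<exists>U \<rho> r. local_defining_function \<Omega> x U \<rho> \<and> 0 < r \<and> cball x r \<subseteq> U"
    if x: "x \<in> frontier \<Omega>" for x
  proof -
    have "\<forall>x\<in>frontier \<Omega>. \<exists>U \<rho>. local_defining_function \<Omega> x U \<rho>"
      using assms unfolding smooth_bounded_domain_def by (elim conjE)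
    from bspec[OF this x] obtain U \<rho> where ldf: "local_defining_function \<Omega> x U \<rho>"
      by blast
    then have "open U" "x \<in> U" by (auto simp: local_defining_function_def)
    then obtain r where "0 < r" "cball x r \<subseteq> U"
      unfolding open_contains_cball by blast
    with ldf show ?thesis by blast
  qed
  then obtain U \<rho> r where loc: "\<And>x. x \<in> frontier \<Omega> \<Longrightarrow> local_defining_function \<Omega> x (U x) (\<rho> x)"
    and r: "\<And>x. x \<in> frontier \<Omega> \<Longrightarrow> 0 < r x" "\<And>x. x \<in> frontier \<Omega> \<Longrightarrow> cball x (r x) \<subseteq> U x"
    by metis
  have "compact (frontier \<Omega>)" using \<Omega> by (rule_tac compact_frontier_bounded)
  moreover have "frontier \<Omega> \<subseteq> (\<Union>x\<in>frontier \<Omega>. ball x (r x))" using r by force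
  ultimately obtain F where F: "F \<subseteq> frontier \<Omega>" "finite F" "frontier \<Omega> \<subseteq> (\<Union>x\<in>F. ball x (r x))"
    using compactE_image[of "frontier \<Omega>" "frontier \<Omega>" "\<lambda>x. ball x (r x)"] by (metis open_ball)
  \<comment> \<open>The third power makes the bump twice continuously differentiable.\<close>
  define \<psi> where "\<psi> x y = max 0 ((r x)\<^sup>2 - (y - x) \<bullet> (y - x)) ^ Suc 2" for x y
  have \<psi>0: "\<psi> x y = 0" if "x \<in> F" "y \<notin> ball x (r x)" for x y
  proof -
    have "(r x)\<^sup>2 \<le> (norm (y - x))\<^sup>2"
      using that r(1)[of x] F(1) by (intro power_mono) (auto simp: dist_norm norm_minus_commute)
    then show ?thesis by (simp add: \<psi>_def dot_square_norm)
  qed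
  have \<psi>pos: "\<psi> x y > 0" if "x \<in> F" "y \<in> ball x (r x)" for x y
  proof -
    have "(norm (y - x))\<^sup>2 < (r x)\<^sup>2"
      using that by (intro power_strict_mono) (auto simp: dist_norm norm_minus_commute)
    then show ?thesis by (simp add: \<psi>_def dot_square_norm)
  qed
  have \<psi>nonneg: "\<psi> x y \<ge> 0" for x y by (simp add: \<psi>_def)
  have \<psi>C: "Ck_on 2 V (\<psi> x)" if "open V" for V x
    unfolding \<psi>_def by (intro Ck_on_max_0_power Ck_on_dist_squared that)
  have C: "Ck_on 2 UNIV (\<lambda>y. \<psi> x y * \<rho> x y)" if "x \<in> F" for x
  proof -
    have x: "x \<in> frontier \<Omega>" using that F by auto
    have U: "open (U x)" "Ck_on 2 (U x) (\<rho> x)"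
      using loc[OF x] by (auto simp: local_defining_function_def Cinf_on_def)
    have "Ck_on 2 (U x) (\<lambda>y. \<psi> x y * \<rho> x y)"
      by (intro Ck_on_mult U \<psi>C)
    moreover have "Ck_on 2 (- cball x (r x)) (\<lambda>y. \<psi> x y * \<rho> x y)"
      by (rule Ck_on_cong[OF _ _ Ck_on_const[where a = 0]]) (use \<psi>0[OF that] in auto)
    ultimately have "Ck_on 2 (U x \<union> - cball x (r x)) (\<lambda>y. \<psi> x y * \<rho> x y)"
      using U by (intro Ck_on_Un) auto
    moreover have "U x \<union> - cball x (r x) = UNIV" using r(2)[OF x] by auto
    ultimately show ?thesis by simp
  qed
  define g where "g y = (\<Sum>x\<in>F. \<psi> x y * \<rho> x y)" for y
  have gC: "Ck_on 2 UNIV g" unfolding g_def by (intro Ck_on_sum C) auto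
  have inU: "y \<in> U x" if "x \<in> F" "\<psi> x y \<noteq> 0" for x y
    using that \<psi>0 r(2)[of x] F(1) by (meson ball_subset_cball in_mono)
  have gfront: "g y = 0" if "y \<in> frontier \<Omega>" for y
    unfolding g_def
  proof (intro sum.neutral ballI)
    fix x assume x: "x \<in> F"
    have "\<rho> x y = 0" if "y \<in> U x"
      using local_defining_function_frontier[OF loc \<open>open \<Omega>\<close> \<open>y \<in> frontier \<Omega>\<close> that] x F(1) by auto
    then show "\<psi> x y * \<rho> x y = 0" using inU[OF x] by auto
  qed
  have gneg: "g y \<le> 0" if "y \<in> \<Omega>" for y
    unfolding g_def
  proof (rule sum_nonpos)
    fix x assume x: "x \<in> F"
    then have "\<Omega> \<inter> U x = {z \<in> U x. \<rho> x z < 0}"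
      using loc F(1) by (auto simp: local_defining_function_def)
    then have "\<rho> x y \<le> 0" if "y \<in> U x" using that \<open>y \<in> \<Omega>\<close> by force
    then show "\<psi> x y * \<rho> x y \<le> 0"
      using inU[OF x, of y] \<psi>nonneg[of x y] by (cases "\<psi> x y = 0") (auto simp: mult_le_0_iff)
  qed
  have gcl: "g y \<le> 0" if "y \<in> closure \<Omega>" for y
    using that gneg gfront closure_Un_frontier[of \<Omega>] by (metis Un_iff order_refl)
  have ggrad: "grad g y \<noteq> 0" if y: "y \<in> frontier \<Omega>" for y
  proof -
    obtain n where n: "outward_unit_normal \<Omega> y n"
      using loc[OF y] by (auto simp: outward_unit_normal_def)
    \<comment> \<open>On the boundary only the term with the derivative of \<open>\<rho> x\<close> survives in the product rule.\<close>
    have *: "\<exists>d. ((\<lambda>y. \<psi> x y * \<rho> x y) has_derivative d) (at y) \<and> d n \<ge> 0 \<and>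
        (y \<in> ball x (r x) \<longrightarrow> d n > 0)" if x: "x \<in> F" for x
    proof (cases "y \<in> U x")
      case True
      have ldf: "local_defining_function \<Omega> x (U x) (\<rho> x)" using loc x F(1) by auto
      then have Ux: "open (U x)" "\<Omega> \<inter> U x = {z \<in> U x. \<rho> x z < 0}" "grad (\<rho> x) y \<noteq> 0"
        using True by (auto simp: local_defining_function_def)
      have d: "\<rho> x differentiable (at y)"
        by (rule local_defining_function_differentiable[OF ldf True])
      have zero: "\<rho> x y = 0"
        by (rule local_defining_function_frontier[OF ldf \<open>open \<Omega>\<close> y True])
      have gn: "grad (\<rho> x) y \<bullet> n = norm (grad (\<rho> x) y)"
        by (rule grad_inner_normal_eq_norm[OF n \<open>open \<Omega>\<close> y d Ux(1) True]) (use zero Ux in force)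
      have "(\<psi> x has_derivative frechet_derivative (\<psi> x) (at y)) (at y)"
        by (rule Ck_on_Suc_has_derivative[of 1 UNIV]) (use \<psi>C[of UNIV x] in \<open>auto simp: numeral_2_eq_2\<close>)
      from has_derivative_mult[OF this has_derivative_grad[OF d]]
      have "((\<lambda>y. \<psi> x y * \<rho> x y) has_derivative (\<lambda>h. \<psi> x y * (grad (\<rho> x) y \<bullet> h))) (at y)"
        by (simp add: zero)
      then show ?thesis
        using \<psi>nonneg[of x y] \<psi>pos[OF x] Ux(3)
        by (intro exI[of _ "\<lambda>h. \<psi> x y * (grad (\<rho> x) y \<bullet> h)"]) (auto simp: gn)
    next
      case False
      then have y': "y \<in> - cball x (r x)" using r(2)[of x] x F(1) by blast
      have "((\<lambda>y. \<psi> x y * \<rho> x y) has_derivative (\<lambda>h. 0)) (at y)"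
        by (rule has_derivative_transform_within_open[OF has_derivative_const[of 0] _ y'])
           (use \<psi>0[OF x] in auto)
      then show ?thesis using y' by (intro exI[of _ "\<lambda>h. 0"]) auto
    qed
    then obtain d where d: "\<And>x. x \<in> F \<Longrightarrow> ((\<lambda>y. \<psi> x y * \<rho> x y) has_derivative d x) (at y)"
        "\<And>x. x \<in> F \<Longrightarrow> d x n \<ge> 0" "\<And>x. x \<in> F \<Longrightarrow> y \<in> ball x (r x) \<Longrightarrow> d x n > 0"
      by metis
    have "(g has_derivative (\<lambda>h. \<Sum>x\<in>F. d x h)) (at y)"
      unfolding g_def by (intro has_derivative_sum d)
    then have "g differentiable (at y)" "frechet_derivative g (at y) n = (\<Sum>x\<in>F. d x n)"
      by (auto simp: differentiable_def frechet_derivative_at[symmetric])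
    then have "grad g y \<bullet> n = (\<Sum>x\<in>F. d x n)" by (simp add: frechet_derivative_eq_grad)
    moreover obtain x where "x \<in> F" "y \<in> ball x (r x)" using F(3) y by auto
    then have "0 < (\<Sum>x\<in>F. d x n)" using d F(2) by (intro sum_pos2[of F x]) auto
    ultimately show ?thesis by auto
  qed
  show thesis by (rule that[OF gC gcl gfront ggrad])
qed

text \<open>For a global defining function \<open>g\<close> take \<open>\<phi> = exp (N * g)\<close>.  It never exceeds \<open>1\<close>, whereas its normal
  derivative on the boundary is \<open>N\<close> times that of \<open>g\<close>: enlarging \<open>N\<close> makes the boundary layer steeper
  without increasing \<open>\<phi>\<close>.\<close>

lemma barrier_function:
  assumes dom: "smooth_bounded_domain \<Omega>"
  obtains \<phi> where "Ck_on 2 UNIV \<phi>" "\<And>x. x \<in> closure \<Omega> \<Longrightarrow> 0 < \<phi> x" "\<And>x. x \<in> closure \<Omega> \<Longrightarrow> \<phi> x \<le> 1"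
    "\<And>x n. x \<in> frontier \<Omega> \<Longrightarrow> outward_unit_normal \<Omega> x n \<Longrightarrow> A < frechet_derivative \<phi> (at x) n"
proof -
  have \<Omega>: "open \<Omega>" "bounded \<Omega>"
    using dom by (auto simp: smooth_bounded_domain_def)
  obtain g where g: "Ck_on 2 UNIV g" "\<And>x. x \<in> closure \<Omega> \<Longrightarrow> g x \<le> 0"
    "\<And>x. x \<in> frontier \<Omega> \<Longrightarrow> g x = 0" "\<And>x. x \<in> frontier \<Omega> \<Longrightarrow> grad g x \<noteq> 0"
    by (rule smooth_bounded_domain_global_defining_function[OF dom]) (rule that)
  have g1: "Ck_on (Suc 1) UNIV g" using g(1) by (simp add: numeral_2_eq_2)
  have gdiff: "g differentiable (at x)" for x
    using Ck_on_Suc_has_derivative[OF g1] by (auto simp: differentiable_def)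
  have "continuous_on (frontier \<Omega>) (\<lambda>x. norm (grad g x))"
    unfolding grad_def
    by (intro continuous_intros continuous_on_subset[OF Ck_on_imp_continuous_on[OF Ck_on_frechet_derivative[OF g1]]]) auto
  moreover have "compact (frontier \<Omega>)" using \<Omega> by (rule_tac compact_frontier_bounded)
  ultimately have "\<exists>c>0. \<forall>x\<in>frontier \<Omega>. c \<le> norm (grad g x)"
  proof (cases "frontier \<Omega> = {}")
    case False
    then obtain x0 where "x0 \<in> frontier \<Omega>" "\<forall>x\<in>frontier \<Omega>. norm (grad g x0) \<le> norm (grad g x)"
      using continuous_attains_inf[OF \<open>compact (frontier \<Omega>)\<close> False \<open>continuous_on (frontier \<Omega>) _\<close>]
      by auto
    then show ?thesis using g(4) by (intro exI[of _ "norm (grad g x0)"]) auto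
  qed (auto intro: exI[of _ 1])
  then obtain c where c: "c > 0" "\<And>x. x \<in> frontier \<Omega> \<Longrightarrow> c \<le> norm (grad g x)" by auto
  define N where "N = (\<bar>A\<bar> + 1) / c"
  have "N * c = \<bar>A\<bar> + 1" using c(1) by (simp add: N_def)
  then have N: "N > 0" "N * c > A" using c(1) by (simp_all add: N_def add_nonneg_pos)
  show thesis
  proof (rule that)
    show "Ck_on 2 UNIV (\<lambda>x. exp (N * g x))"
      by (intro Ck_on_exp Ck_on_mult Ck_on_const g) auto
    show "0 < exp (N * g x)" for x by simp
    show "exp (N * g x) \<le> 1" if "x \<in> closure \<Omega>" for x
      using g(2)[OF that] N by (simp add: mult_le_0_iff)
    fix x n assume x: "x \<in> frontier \<Omega>" and n: "outward_unit_normal \<Omega> x n"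
    have gn: "grad g x \<bullet> n = norm (grad g x)"
      by (rule grad_inner_normal_eq_norm[OF n \<Omega>(1) x gdiff, of UNIV])
         (use g(2,3) x closure_subset in auto)
    have "((\<lambda>x. exp (N * g x)) has_derivative (\<lambda>h. N * (grad g x \<bullet> h))) (at x)"
      using has_derivative_grad[OF gdiff, of x] g(3)[OF x] by (auto intro!: derivative_eq_intros)
    from frechet_derivative_at[OF this, symmetric]
    have "frechet_derivative (\<lambda>x. exp (N * g x)) (at x) n = N * norm (grad g x)"
      by (simp add: gn)
    moreover have "N * c \<le> N * norm (grad g x)" using N(1) c(2)[OF x] by (intro mult_left_mono) auto
    ultimately show "A < frechet_derivative (\<lambda>x. exp (N * g x)) (at x) n" using N(2) by linarith
  qed
qed

section \<open>A maximum principle with nonlocal flux\<close>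

lemma second_derivative_nonpos_at_local_max:
  fixes f :: "real \<Rightarrow> real"
  assumes "d > 0" and f: "\<And>s. \<bar>s\<bar> < d \<Longrightarrow> (f has_real_derivative f' s) (at s)"
    and f'': "(f' has_real_derivative l) (at 0)"
    and max: "\<And>s. \<bar>s\<bar> < d \<Longrightarrow> f s \<le> f 0"
  shows "l \<le> 0"
proof (rule ccontr)
  assume "\<not> l \<le> 0"
  then obtain e where e: "e > 0" "\<And>s. 0 < s \<Longrightarrow> s < e \<Longrightarrow> f' 0 < f' s"
    using DERIV_pos_inc_right[OF f''] by auto
  have "f' 0 = 0"
    by (rule DERIV_local_max[OF f \<open>d > 0\<close>]) (use assms in auto)
  define s where "s = min d e / 2"
  have s: "0 < s" "s < d" "s < e" using \<open>d > 0\<close> e(1) by (auto simp: s_def)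
  have "f 0 < f s"
  proof (rule DERIV_pos_imp_increasing_open[OF s(1)])
    show "\<exists>y. (f has_real_derivative y) (at x) \<and> 0 < y" if "0 < x" "x < s" for x
      using f[of x] e(2)[of x] that s \<open>f' 0 = 0\<close> by auto
    show "continuous_on {0..s} f"
      by (rule DERIV_atLeastAtMost_imp_continuous_on) (use f s in force)
  qed
  then show False using max[of s] s by auto
qed

lemma directional_second_derivative_nonpos_at_max:
  fixes f :: "'a::euclidean_space \<Rightarrow> real"
  assumes "open \<Omega>" "x \<in> \<Omega>"
    and f: "\<And>y. y \<in> \<Omega> \<Longrightarrow> (f has_derivative f' y) (at y)"
    and f'': "((\<lambda>y. f' y b) has_derivative f'') (at x)"
    and max: "\<And>y. y \<in> \<Omega> \<Longrightarrow> f y \<le> f x"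
  shows "f'' b \<le> 0"
proof -
  have "((\<lambda>s. x + s *\<^sub>R b) \<longlongrightarrow> x + 0 *\<^sub>R b) (at 0)"
    by (intro tendsto_intros)
  then have "eventually (\<lambda>s. x + s *\<^sub>R b \<in> \<Omega>) (at 0)"
    using assms by (intro topological_tendstoD) auto
  then obtain d where d: "d > 0" "\<And>s. s \<noteq> 0 \<Longrightarrow> \<bar>s\<bar> < d \<Longrightarrow> x + s *\<^sub>R b \<in> \<Omega>"
    by (auto simp: eventually_at)
  have d': "x + s *\<^sub>R b \<in> \<Omega>" if "\<bar>s\<bar> < d" for s
    using d(2)[of s] that assms(2) by (cases "s = 0") auto
  show ?thesis
  proof (rule second_derivative_nonpos_at_local_max[OF d(1), where f = "\<lambda>s. f (x + s *\<^sub>R b)"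
        and f' = "\<lambda>s. f' (x + s *\<^sub>R b) b"])
    show "((\<lambda>s. f (x + s *\<^sub>R b)) has_real_derivative f' (x + s *\<^sub>R b) b) (at s)" if "\<bar>s\<bar> < d" for s
    proof -
      have "((\<lambda>r. f ((x + s *\<^sub>R b) + r *\<^sub>R b)) has_real_derivative f' (x + s *\<^sub>R b) b) (at 0)"
        by (rule has_real_derivative_along_ray[OF f[OF d'[OF that]]]) simp
      then have "((\<lambda>r. f (x + (s + r) *\<^sub>R b)) has_real_derivative f' (x + s *\<^sub>R b) b) (at 0)"
        by (simp add: algebra_simps)
      then show ?thesis
        using DERIV_at_within_shift[of "\<lambda>s. f (x + s *\<^sub>R b)" _ s 0 UNIV] by simp
    qed
    show "((\<lambda>s. f' (x + s *\<^sub>R b) b) has_real_derivative f'' b) (at 0)"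
      by (rule has_real_derivative_along_ray[OF f'']) simp
  qed (use max d' in auto)
qed

text \<open>Write \<open>w\<close> as \<open>exp (\<mu> * t) * \<phi> x\<close> times a quotient \<open>z\<close>, with the barrier \<open>\<phi>\<close>, and consider a
  positive maximum \<open>M\<close> of \<open>z\<close>.  It cannot lie on the lateral boundary: there the normal derivative
  of \<open>w\<close> is at least \<open>M * exp (\<mu> * t)\<close> times that of \<open>\<phi>\<close>, which exceeds \<open>A * M * exp (\<mu> * t)\<close>,
  while \<open>\<phi> \<le> 1\<close> bounds \<open>w\<close> by \<open>M * exp (\<mu> * t)\<close> and hence the flux by \<open>A * M * exp (\<mu> * t)\<close>.
  It cannot lie inside either, because \<open>\<mu>\<close> is so large that \<open>exp (\<mu> * t) * \<phi> x\<close> is a strict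
  supersolution of the linear equation.  The steep barrier replaces the boundary point lemma of
  Hopf: a weak inequality for the normal derivative at the maximum is enough.

  The flux condition is stated through upper bounds of \<open>w\<close>, since this is all that a nonlocal boundary
  operator with bounded nonnegative kernel contributes.\<close>

lemma nonlocal_flux_maximum_principle:
  fixes w wt :: "'a::euclidean_space \<Rightarrow> real \<Rightarrow> real"
    and D E :: "'a \<Rightarrow> real \<Rightarrow> 'a \<Rightarrow> real" and H :: "'a \<Rightarrow> real \<Rightarrow> 'a \<Rightarrow> 'a \<Rightarrow> real"
  assumes dom: "smooth_bounded_domain \<Omega>"
    and \<nu>: "\<And>x. x \<in> frontier \<Omega> \<Longrightarrow> outward_unit_normal \<Omega> x (\<nu> x)"
    and cont: "continuous_on (closure \<Omega> \<times> {0..T}) (\<lambda>(x, t). w x t)"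
    and init: "\<And>x. x \<in> closure \<Omega> \<Longrightarrow> w x 0 \<le> 0"
    and wt: "\<And>x t. x \<in> \<Omega> \<Longrightarrow> 0 < t \<Longrightarrow> t \<le> T \<Longrightarrow> (w x has_real_derivative wt x t) (at t)"
    and D: "\<And>x t. x \<in> \<Omega> \<Longrightarrow> 0 < t \<Longrightarrow> t \<le> T \<Longrightarrow> ((\<lambda>y. w y t) has_derivative D x t) (at x)"
    and H: "\<And>x t b. x \<in> \<Omega> \<Longrightarrow> 0 < t \<Longrightarrow> t \<le> T \<Longrightarrow> b \<in> Basis \<Longrightarrow>
              ((\<lambda>y. D y t b) has_derivative H x t b) (at x)"
    and pde: "\<And>x t. x \<in> \<Omega> \<Longrightarrow> 0 < t \<Longrightarrow> t \<le> T \<Longrightarrow>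
              wt x t \<le> (\<Sum>b\<in>Basis. H x t b b) + C * max 0 (w x t)"
    and E: "\<And>x t. x \<in> frontier \<Omega> \<Longrightarrow> 0 < t \<Longrightarrow> t \<le> T \<Longrightarrow>
              ((\<lambda>y. w y t) has_derivative E x t) (at x within closure \<Omega>)"
    and flux: "\<And>x t B. x \<in> frontier \<Omega> \<Longrightarrow> 0 < t \<Longrightarrow> t \<le> T \<Longrightarrow> 0 \<le> B \<Longrightarrow>
              (\<And>y. y \<in> \<Omega> \<Longrightarrow> w y t \<le> B) \<Longrightarrow> E x t (\<nu> x) \<le> A * B"
    and xt: "x \<in> closure \<Omega>" "0 \<le> t" "t \<le> T"
  shows "w x t \<le> 0"
proof (rule ccontr)
  assume "\<not> w x t \<le> 0"
  then have wpos: "w x t > 0" by simp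
  have \<Omega>: "open \<Omega>" "bounded \<Omega>"
    using dom by (auto simp: smooth_bounded_domain_def)
  have K: "compact (closure \<Omega>)" using \<Omega> by (simp add: compact_closure)
  obtain \<phi> where \<phi>: "Ck_on 2 UNIV \<phi>" "\<And>x. x \<in> closure \<Omega> \<Longrightarrow> 0 < \<phi> x" "\<And>x. x \<in> closure \<Omega> \<Longrightarrow> \<phi> x \<le> 1"
    "\<And>x n. x \<in> frontier \<Omega> \<Longrightarrow> outward_unit_normal \<Omega> x n \<Longrightarrow> A < frechet_derivative \<phi> (at x) n"
    by (rule barrier_function[OF dom, of A]) (rule that)
  have \<phi>2: "Ck_on (Suc (Suc 0)) UNIV \<phi>" using \<phi>(1) by (simp add: numeral_2_eq_2)
  define \<phi>' where "\<phi>' x = frechet_derivative \<phi> (at x)" for x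
  define \<phi>'' where "\<phi>'' b x = frechet_derivative (\<lambda>y. \<phi>' y b) (at x)" for b x
  have \<phi>': "(\<phi> has_derivative \<phi>' x) (at x)" for x
    unfolding \<phi>'_def by (rule Ck_on_Suc_has_derivative[OF \<phi>2]) simp
  have \<phi>'1: "Ck_on (Suc 0) UNIV (\<lambda>y. \<phi>' y b)" if "b \<in> Basis" for b
    unfolding \<phi>'_def by (rule Ck_on_frechet_derivative[OF \<phi>2 that])
  have \<phi>'': "((\<lambda>y. \<phi>' y b) has_derivative \<phi>'' b x) (at x)" if "b \<in> Basis" for b x
    unfolding \<phi>''_def by (rule Ck_on_Suc_has_derivative[OF \<phi>'1[OF that]]) simp
  have cont\<phi>: "continuous_on S \<phi>" for S
    using Ck_on_imp_continuous_on[OF \<phi>(1)] continuous_on_subset by blast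
  have "continuous_on (closure \<Omega>) (\<lambda>x. \<Sum>b\<in>Basis. \<phi>'' b x b)"
    unfolding \<phi>''_def
    by (intro continuous_intros
        continuous_on_subset[OF Ck_on_imp_continuous_on[OF Ck_on_frechet_derivative[OF \<phi>'1]]]) auto
  from compact_imp_bounded[OF compact_continuous_image[OF this K]]
  obtain Q where Q: "\<And>x. x \<in> closure \<Omega> \<Longrightarrow> \<bar>\<Sum>b\<in>Basis. \<phi>'' b x b\<bar> \<le> Q"
    by (auto simp: bounded_iff)
  obtain x1 where x1: "x1 \<in> closure \<Omega>" "\<And>y. y \<in> closure \<Omega> \<Longrightarrow> \<phi> x1 \<le> \<phi> y"
    using continuous_attains_inf[OF K _ cont\<phi>[of "closure \<Omega>"]] xt(1) by (metis empty_iff)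
  define m where "m = \<phi> x1"
  have m: "m > 0" using \<phi>(2)[OF x1(1)] by (simp add: m_def)
  \<comment> \<open>Chosen so that \<open>\<mu> * \<phi>\<close> dominates the Laplacian of \<open>\<phi>\<close> plus \<open>C * \<phi>\<close>.\<close>
  define \<mu> where "\<mu> = \<bar>C\<bar> + (\<bar>Q\<bar> + 1) / m"
  have \<mu>: "\<mu> * \<phi> y > (\<Sum>b\<in>Basis. \<phi>'' b y b) + C * \<phi> y" if "y \<in> closure \<Omega>" for y
  proof -
    have "\<phi> y \<ge> m" using x1(2)[OF that] by (simp add: m_def)
    then have "(\<bar>Q\<bar> + 1) / m * \<phi> y \<ge> (\<bar>Q\<bar> + 1) / m * m"
      using m by (intro mult_left_mono) auto
    then have "(\<bar>Q\<bar> + 1) / m * \<phi> y \<ge> \<bar>Q\<bar> + 1" using m by simp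
    moreover have "\<bar>C\<bar> * \<phi> y \<ge> C * \<phi> y" using \<phi>(2)[OF that] by (intro mult_right_mono) auto
    moreover have "\<mu> * \<phi> y = \<bar>C\<bar> * \<phi> y + (\<bar>Q\<bar> + 1) / m * \<phi> y"
      unfolding \<mu>_def by (rule distrib_right)
    ultimately show ?thesis using Q[OF that] by linarith
  qed
  let ?S = "closure \<Omega> \<times> {0..T}"
  define z where "z = (\<lambda>(x, t). w x t / (exp (\<mu> * t) * \<phi> x))"
  have "continuous_on ?S z"
  proof -
    have "continuous_on ?S (\<lambda>q. (case q of (x, t) \<Rightarrow> w x t) / (exp (\<mu> * snd q) * \<phi> (fst q)))"
      using \<phi>(2) by (intro continuous_intros cont continuous_on_compose2[OF cont\<phi>[of UNIV]])
        (auto simp: less_imp_neq[THEN not_sym])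
    then show ?thesis by (simp add: z_def case_prod_beta)
  qed
  moreover have "compact ?S" "?S \<noteq> {}" using K xt by (auto intro: compact_Times)
  ultimately obtain x0 t0 where x0: "x0 \<in> closure \<Omega>" "0 \<le> t0" "t0 \<le> T"
    and max: "\<And>y s. y \<in> closure \<Omega> \<Longrightarrow> 0 \<le> s \<Longrightarrow> s \<le> T \<Longrightarrow> z (y, s) \<le> z (x0, t0)"
    using continuous_attains_sup[of ?S z] by fastforce
  define M where "M = z (x0, t0)"
  have "z (x, t) > 0" using wpos \<phi>(2)[OF xt(1)] by (simp add: z_def)
  then have M: "M > 0" using max[OF xt] by (simp add: M_def)
  \<comment> \<open>Instead of differentiating a quotient, compare \<open>w\<close> with the multiple of the barrier that
    touches it from above.\<close>
  define h where "h y s = w y s - M * exp (\<mu> * s) * \<phi> y" for y s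
  have h0: "h x0 t0 = 0"
    using \<phi>(2)[OF x0(1)] by (simp add: h_def M_def z_def)
  have hle: "h y s \<le> h x0 t0" if "y \<in> closure \<Omega>" "0 \<le> s" "s \<le> T" for y s
  proof -
    have "w y s / (exp (\<mu> * s) * \<phi> y) \<le> M" using max[OF that] by (simp add: M_def z_def)
    then show ?thesis
      using \<phi>(2)[OF that(1)] unfolding h0 by (simp add: h_def pos_divide_le_eq mult.assoc)
  qed
  have w0: "w x0 t0 = M * exp (\<mu> * t0) * \<phi> x0" using h0 by (simp add: h_def)
  have "w x0 t0 > 0" using w0 M \<phi>(2)[OF x0(1)] by simp
  then have t0: "t0 > 0" using init[OF x0(1)] x0(2) by (cases "t0 = 0") auto
  have scale: "M * exp (\<mu> * t0) > 0" using M by simp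
  consider "x0 \<in> \<Omega>" | "x0 \<in> frontier \<Omega>"
    using x0(1) closure_Un_frontier[of \<Omega>] by blast
  then show False
  proof cases
    case 1
    have "(h x0 has_real_derivative wt x0 t0 - M * (\<mu> * exp (\<mu> * t0)) * \<phi> x0) (at t0)"
      unfolding h_def by (rule derivative_eq_intros wt[OF 1 t0 x0(3)] refl | simp)+
    then have time: "wt x0 t0 - M * (\<mu> * exp (\<mu> * t0)) * \<phi> x0 \<ge> 0"
    proof (rule_tac ccontr)
      assume der: "(h x0 has_real_derivative wt x0 t0 - M * (\<mu> * exp (\<mu> * t0)) * \<phi> x0) (at t0)"
        and "\<not> wt x0 t0 - M * (\<mu> * exp (\<mu> * t0)) * \<phi> x0 \<ge> 0"
      then obtain d where d: "d > 0" "\<And>s. 0 < s \<Longrightarrow> s < d \<Longrightarrow> h x0 t0 < h x0 (t0 - s)"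
        using DERIV_neg_dec_left[OF der] by auto
      define s where "s = min d t0 / 2"
      have s: "0 < s" "s < d" "s < t0" using d(1) t0 by (auto simp: s_def)
      show False using d(2)[OF s(1,2)] hle[OF x0(1), of "t0 - s"] s x0 by auto
    qed
    have "H x0 t0 b b - M * exp (\<mu> * t0) * \<phi>'' b x0 b \<le> 0" if b: "b \<in> Basis" for b
    proof (rule directional_second_derivative_nonpos_at_max[OF \<Omega>(1) 1, where f = "\<lambda>y. h y t0"
          and f' = "\<lambda>y k. D y t0 k - M * exp (\<mu> * t0) * \<phi>' y k"
          and f'' = "\<lambda>k. H x0 t0 b k - M * exp (\<mu> * t0) * \<phi>'' b x0 k"])
      show "((\<lambda>y. h y t0) has_derivative (\<lambda>k. D y t0 k - M * exp (\<mu> * t0) * \<phi>' y k)) (at y)"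
        if "y \<in> \<Omega>" for y
        unfolding h_def
        by (intro has_derivative_diff D that t0 x0 has_derivative_mult_right \<phi>')
      show "((\<lambda>y. D y t0 b - M * exp (\<mu> * t0) * \<phi>' y b) has_derivative
          (\<lambda>k. H x0 t0 b k - M * exp (\<mu> * t0) * \<phi>'' b x0 k)) (at x0)"
        by (intro has_derivative_diff H 1 t0 x0 has_derivative_mult_right \<phi>'' b)
      show "h y t0 \<le> h x0 t0" if "y \<in> \<Omega>" for y
        using hle[of y t0] that closure_subset x0 by blast
    qed
    then have "(\<Sum>b\<in>Basis. H x0 t0 b b) \<le> (\<Sum>b\<in>Basis. M * exp (\<mu> * t0) * \<phi>'' b x0 b)"
      by (intro sum_mono) simp
    also have "\<dots> = M * exp (\<mu> * t0) * (\<Sum>b\<in>Basis. \<phi>'' b x0 b)"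
      by (simp add: sum_distrib_left)
    finally have "wt x0 t0 \<le> M * exp (\<mu> * t0) * (\<Sum>b\<in>Basis. \<phi>'' b x0 b) + C * w x0 t0"
      using pde[OF 1 t0 x0(3)] \<open>w x0 t0 > 0\<close> by simp
    then have "M * exp (\<mu> * t0) * (\<mu> * \<phi> x0) \<le>
        M * exp (\<mu> * t0) * ((\<Sum>b\<in>Basis. \<phi>'' b x0 b) + C * \<phi> x0)"
      using time unfolding w0 by (simp add: algebra_simps)
    then have "\<mu> * \<phi> x0 \<le> (\<Sum>b\<in>Basis. \<phi>'' b x0 b) + C * \<phi> x0"
      using scale by (simp only: mult_le_cancel_left_pos)
    then show False using \<mu>[OF x0(1)] by simp
  next
    case 2
    let ?n = "\<nu> x0"
    have n: "outward_unit_normal \<Omega> x0 ?n" by (rule \<nu>[OF 2])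
    have "?n \<bullet> (- ?n) < 0" using norm_outward_unit_normal[OF n] by (simp add: dot_square_norm)
    then obtain d where d: "d > 0" "\<And>s. 0 < s \<Longrightarrow> s < d \<Longrightarrow> x0 + s *\<^sub>R (- ?n) \<in> \<Omega>"
      by (rule inward_direction[OF n \<Omega>(1) 2]) auto
    have der: "((\<lambda>y. h y t0) has_derivative (\<lambda>k. E x0 t0 k - M * exp (\<mu> * t0) * \<phi>' x0 k))
        (at x0 within closure \<Omega>)"
      unfolding h_def
      by (intro has_derivative_diff E 2 t0 x0 has_derivative_mult_right has_derivative_at_withinI[OF \<phi>'])
    have "E x0 t0 (- ?n) - M * exp (\<mu> * t0) * \<phi>' x0 (- ?n) \<le> 0"
    proof (rule has_derivative_nonpos_along_inward_ray[OF der d(1) _ x0(1)])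
      show "x0 + s *\<^sub>R (- ?n) \<in> closure \<Omega> \<and> h (x0 + s *\<^sub>R (- ?n)) t0 \<le> h x0 t0"
        if "0 < s" "s < d" for s
        using d(2)[OF that] closure_subset[of \<Omega>] hle[of "x0 + s *\<^sub>R (- ?n)" t0] x0 by blast
    qed
    moreover have "E x0 t0 (- ?n) = - E x0 t0 ?n"
      by (rule linear_neg[OF has_derivative_linear[OF E[OF 2 t0 x0(3)]]])
    moreover have "\<phi>' x0 (- ?n) = - \<phi>' x0 ?n"
      by (rule linear_neg[OF has_derivative_linear[OF \<phi>']])
    ultimately have "M * exp (\<mu> * t0) * \<phi>' x0 ?n \<le> E x0 t0 ?n" by simp
    also have "\<dots> \<le> A * (M * exp (\<mu> * t0))"
    proof (rule flux[OF 2 t0 x0(3)])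
      fix y assume "y \<in> \<Omega>"
      then have y: "y \<in> closure \<Omega>" using closure_subset by blast
      have "w y t0 \<le> M * exp (\<mu> * t0) * \<phi> y" using hle[OF y x0(2,3)] h0 by (simp add: h_def)
      also have "\<dots> \<le> M * exp (\<mu> * t0) * 1" by (rule mult_left_mono) (use \<phi>(3)[OF y] scale in auto)
      finally show "w y t0 \<le> M * exp (\<mu> * t0)" by simp
    qed (use scale in simp)
    finally have "\<phi>' x0 ?n \<le> A"
      using scale by (simp add: mult.commute[of A] mult_le_cancel_left_pos)
    then show False using \<phi>(4)[OF 2 n] by (simp add: \<phi>'_def)
  qed
qed

section \<open>One-sided Lipschitz bounds for powers\<close>

text \<open>Divide by \<open>b powr q\<close>, put \<open>s = a / b \<le> 1\<close> and use Bernoulli: \<open>s powr q \<ge> s ^ n \<ge> 1 - n * (1 - s)\<close>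
  for an integer \<open>n \<ge> q\<close>.  For \<open>q < 1\<close> the estimate is singular only in the larger number \<open>b\<close>, so
  positivity of either of two functions suffices to make it a uniform bound where they are ordered.\<close>

lemma powr_diff_le:
  fixes a b q :: real
  assumes "q > 0" "0 \<le> a" "a \<le> b" "0 < b"
  shows "b powr q - a powr q \<le> real (nat \<lceil>q\<rceil>) * b powr (q - 1) * (b - a)"
proof -
  define n where "n = nat \<lceil>q\<rceil>"
  have n: "q \<le> real n" "n > 0" using assms(1) by (simp_all add: n_def real_nat_ceiling_ge)
  define s where "s = a / b"
  have s: "0 \<le> s" "s \<le> 1" using assms by (auto simp: s_def)
  have "1 - real n * (1 - s) \<le> s ^ n"
    using Bernoulli_inequality[of "s - 1" n] s by (simp add: algebra_simps)
  also have "\<dots> \<le> s powr q"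
  proof (cases "s = 0")
    case False
    then have "s powr real n \<le> s powr q"
      using s n by (intro powr_mono') auto
    then show ?thesis using False s by (simp add: powr_realpow)
  qed (use n in \<open>auto simp: zero_power\<close>)
  finally have "1 - s powr q \<le> real n * (1 - s)" by simp
  then have "b powr q * (1 - s powr q) \<le> b powr q * (real n * (1 - s))"
    by (intro mult_left_mono) auto
  moreover have "b powr q * s powr q = a powr q"
    using assms by (simp add: s_def powr_mult[symmetric])
  moreover have "b powr q * (real n * (1 - s)) = real n * b powr (q - 1) * (b - a)"
    using assms by (simp add: s_def powr_diff field_simps)
  ultimately show ?thesis by (simp add: n_def algebra_simps)
qed

text \<open>Only points with \<open>f z < g z\<close> matter, and there a positive lower bound for \<open>f\<close> is one for \<open>g\<close> too.\<close>

lemma powr_one_sided_Lipschitz_on_compact: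
  fixes f g :: "'b::topological_space \<Rightarrow> real"
  assumes "compact K" "continuous_on K f" "continuous_on K g" "q > 0"
    and nonneg: "\<And>z. z \<in> K \<Longrightarrow> 0 \<le> f z" "\<And>z. z \<in> K \<Longrightarrow> 0 \<le> g z"
    and pos: "q < 1 \<Longrightarrow> (\<forall>z\<in>K. 0 < f z) \<or> (\<forall>z\<in>K. 0 < g z)"
  obtains L where "0 \<le> L" "\<And>z. z \<in> K \<Longrightarrow> g z powr q - f z powr q \<le> L * max 0 (g z - f z)"
proof -
  have "\<exists>B. \<forall>z\<in>K. f z < g z \<longrightarrow> g z powr (q - 1) \<le> B"
  proof (cases "q < 1")
    case False
    obtain G where G: "\<And>z. z \<in> K \<Longrightarrow> g z \<le> G"
      using compact_imp_bounded[OF compact_continuous_image[OF assms(3,1)]]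
      by (auto simp: bounded_iff abs_le_iff)
    show ?thesis
      using False G nonneg by (intro exI[of _ "G powr (q - 1)"]) (auto intro!: powr_mono2)
  next
    case True
    have "\<exists>m>0. \<forall>z\<in>K. m \<le> k z" if k: "continuous_on K k" "\<forall>z\<in>K. 0 < k z" for k :: "'b \<Rightarrow> real"
    proof (cases "K = {}")
      case False
      then obtain z where "z \<in> K" "\<forall>y\<in>K. k z \<le> k y"
        using continuous_attains_inf[OF assms(1) False k(1)] by auto
      then show ?thesis using k(2) by (intro exI[of _ "k z"]) auto
    qed (auto intro: exI[of _ 1])
    then obtain m where m: "m > 0" "(\<forall>z\<in>K. m \<le> f z) \<or> (\<forall>z\<in>K. m \<le> g z)"
      using pos[OF True] assms(2,3) by metis
    have "g z powr (q - 1) \<le> m powr (q - 1)" if "z \<in> K" "f z < g z" for z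
      using m that True by (intro powr_mono2') fastforce+
    then show ?thesis by blast
  qed
  then obtain B where B: "\<And>z. z \<in> K \<Longrightarrow> f z < g z \<Longrightarrow> g z powr (q - 1) \<le> B" by blast
  show thesis
  proof
    show "0 \<le> real (nat \<lceil>q\<rceil>) * \<bar>B\<bar>" by simp
    fix z assume z: "z \<in> K"
    show "g z powr q - f z powr q \<le> real (nat \<lceil>q\<rceil>) * \<bar>B\<bar> * max 0 (g z - f z)"
    proof (cases "f z < g z")
      case True
      have "g z powr q - f z powr q \<le> real (nat \<lceil>q\<rceil>) * g z powr (q - 1) * (g z - f z)"
        using True nonneg(1)[OF z] \<open>q > 0\<close> by (intro powr_diff_le) auto
      also have "\<dots> \<le> real (nat \<lceil>q\<rceil>) * \<bar>B\<bar> * (g z - f z)"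
        using True B[OF z True] by (intro mult_right_mono mult_left_mono) auto
      finally show ?thesis using True by simp
    next
      case False
      then show ?thesis using nonneg(2)[OF z] \<open>q > 0\<close> by (simp add: powr_mono2)
    qed
  qed
qed

section \<open>The comparison principle\<close>

lemma cylinder_Un_parabolic_boundary:
  assumes "T > 0"
  shows "cylinder \<Omega> T \<union> parabolic_boundary \<Omega> T = closure \<Omega> \<times> {0..<T}"
  using assms closure_Un_frontier[of \<Omega>]
  by (auto simp: cylinder_def parabolic_boundary_def lateral_boundary_def order_le_less)

lemma C21_derivatives:
  assumes "C21 \<Omega> T u" "x \<in> \<Omega>" "0 < t" "t < T"
  shows "(u x has_real_derivative time_deriv u x t) (at t)"
    and "((\<lambda>y. u y t) has_derivative frechet_derivative (\<lambda>y. u y t) (at x)) (at x)"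
    and "b \<in> Basis \<Longrightarrow> ((\<lambda>y. frechet_derivative (\<lambda>z. u z t) (at y) b) has_derivative
           frechet_derivative (\<lambda>y. space_deriv b u y t) (at x)) (at x)"
proof -
  have xt: "(x, t) \<in> cylinder \<Omega> T" using assms by (simp add: cylinder_def)
  have "u x differentiable (at t)" using assms(1) xt unfolding C21_def by blast
  then show "(u x has_real_derivative time_deriv u x t) (at t)"
    by (simp add: time_deriv_def DERIV_deriv_iff_real_differentiable)
  have "(\<lambda>y. u y t) differentiable (at x)" using assms(1) xt unfolding C21_def by blast
  then show "((\<lambda>y. u y t) has_derivative frechet_derivative (\<lambda>y. u y t) (at x)) (at x)"
    by (simp add: frechet_derivative_works)
  show "((\<lambda>y. frechet_derivative (\<lambda>z. u z t) (at y) b) has_derivative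
           frechet_derivative (\<lambda>y. space_deriv b u y t) (at x)) (at x)" if "b \<in> Basis"
  proof -
    have "(\<lambda>y. space_deriv b u y t) differentiable (at x)"
      using assms(1) xt that unfolding C21_def by blast
    then have "((\<lambda>y. space_deriv b u y t) has_derivative
        frechet_derivative (\<lambda>y. space_deriv b u y t) (at x)) (at x)"
      by (simp add: frechet_derivative_works)
    then show ?thesis by (simp add: space_deriv_def)
  qed
qed

lemma holder_loc_on_bounded:
  assumes "holder_loc_on \<alpha> A f" "compact K" "K \<subseteq> A" "0 < \<alpha>"
  obtains C where "\<And>z. z \<in> K \<Longrightarrow> \<bar>f z\<bar> \<le> C"
proof (cases "K = {}")
  case False
  then obtain w where w: "w \<in> K" by auto
  obtain C where C: "\<And>z w. z \<in> K \<Longrightarrow> w \<in> K \<Longrightarrow> \<bar>f z - f w\<bar> \<le> C * dist z w powr \<alpha>"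
    using assms(1-3) unfolding holder_loc_on_def by meson
  have "\<bar>f z\<bar> \<le> \<bar>f w\<bar> + \<bar>C\<bar> * diameter K powr \<alpha>" if z: "z \<in> K" for z
  proof -
    have "dist z w \<le> diameter K"
      using diameter_bounded_bound[OF compact_imp_bounded[OF assms(2)] z w] .
    then have "dist z w powr \<alpha> \<le> diameter K powr \<alpha>"
      using assms(4) by (intro powr_mono2) auto
    then have "C * dist z w powr \<alpha> \<le> \<bar>C\<bar> * diameter K powr \<alpha>"
      by (intro mult_mono) auto
    then show ?thesis using C[OF z w] by linarith
  qed
  then show thesis by (rule that)
qed (auto intro: that)

lemma set_integrable_lborel_continuous_on_closure:
  fixes f :: "'a::euclidean_space \<Rightarrow> real"
  assumes "open \<Omega>" "bounded \<Omega>" "continuous_on (closure \<Omega>) f"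
  shows "set_integrable lborel \<Omega> f"
proof (rule set_integrable_subset)
  show "set_integrable lborel (closure \<Omega>) f"
    unfolding set_integrable_def
    using assms by (intro borel_integrable_compact) (auto simp: compact_closure)
qed (use assms closure_subset in auto)

theorem theorem2p4:
  fixes \<Omega> :: "'a::euclidean_space set"
    and \<nu> :: "'a \<Rightarrow> 'a"
    and c :: "'a \<Rightarrow> real \<Rightarrow> real"
    and k :: "'a \<Rightarrow> 'a \<Rightarrow> real \<Rightarrow> real"
    and u0 :: "'a \<Rightarrow> real"
    and u v :: "'a \<Rightarrow> real \<Rightarrow> real"
    and p l \<alpha> T :: real
  assumes "p > 0" and "l > 0"
    and "smooth_bounded_domain \<Omega>"
    and "\<forall>x\<in>frontier \<Omega>. outward_unit_normal \<Omega> x (\<nu> x)"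
    and "0 < \<alpha>" and "\<alpha> < 1"
    and "holder_loc_on \<alpha> (closure \<Omega> \<times> {0..}) (\<lambda>(x, t). c x t)"
    and "\<forall>x\<in>closure \<Omega>. \<forall>t\<ge>0. c x t \<ge> 0"
    and "continuous_on (frontier \<Omega> \<times> closure \<Omega> \<times> {0..}) (\<lambda>(x, y, t). k x y t)"
    and "\<forall>x\<in>frontier \<Omega>. \<forall>y\<in>closure \<Omega>. \<forall>t\<ge>0. k x y t \<ge> 0"
    and "C1_closure \<Omega> u0"
    and "\<forall>x\<in>\<Omega>. u0 x \<ge> 0"
    and "\<forall>x\<in>frontier \<Omega>.
           dir_deriv \<Omega> u0 (\<nu> x) x = (LINT y:\<Omega>|lborel. k x y 0 * u0 y powr l)"
    and "T > 0"
    and "supersolution \<Omega> \<nu> c k p l u0 T u"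
    and "subsolution \<Omega> \<nu> c k p l u0 T v"
    and "\<forall>x\<in>\<Omega>. u x 0 \<ge> v x 0"
    and "min p l < 1 \<longrightarrow>
           (\<forall>(x, t)\<in>cylinder \<Omega> T \<union> parabolic_boundary \<Omega> T. u x t > 0) \<or>
           (\<forall>(x, t)\<in>cylinder \<Omega> T \<union> parabolic_boundary \<Omega> T. v x t > 0)"
  shows "\<forall>(x, t)\<in>cylinder \<Omega> T \<union> parabolic_boundary \<Omega> T. u x t \<ge> v x t"
proof -
  let ?D = "closure \<Omega> \<times> {0..<T}"
  note D_eq = cylinder_Un_parabolic_boundary[OF \<open>T > 0\<close>, of \<Omega>]
  have \<Omega>: "open \<Omega>" "bounded \<Omega>"
    using \<open>smooth_bounded_domain \<Omega>\<close> by (auto simp: smooth_bounded_domain_def)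
  have K: "compact (closure \<Omega>)" using \<Omega> by (simp add: compact_closure)
  have u: "C21 \<Omega> T u" "C10 \<Omega> T u" "\<And>x t. (x, t) \<in> ?D \<Longrightarrow> 0 \<le> u x t"
    "\<And>x t. x \<in> \<Omega> \<Longrightarrow> 0 < t \<Longrightarrow> t < T \<Longrightarrow> laplacian u x t + c x t * u x t powr p \<le> time_deriv u x t"
    "\<And>x t. x \<in> frontier \<Omega> \<Longrightarrow> 0 < t \<Longrightarrow> t < T \<Longrightarrow>
       (LINT y:\<Omega>|lborel. k x y t * u y t powr l) \<le> dir_deriv \<Omega> (\<lambda>y. u y t) (\<nu> x) x"
    using \<open>supersolution \<Omega> \<nu> c k p l u0 T u\<close> unfolding supersolution_def D_eq
    by (auto simp: cylinder_def lateral_boundary_def)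
  have v: "C21 \<Omega> T v" "C10 \<Omega> T v" "\<And>x t. (x, t) \<in> ?D \<Longrightarrow> 0 \<le> v x t"
    "\<And>x t. x \<in> \<Omega> \<Longrightarrow> 0 < t \<Longrightarrow> t < T \<Longrightarrow> time_deriv v x t \<le> laplacian v x t + c x t * v x t powr p"
    "\<And>x t. x \<in> frontier \<Omega> \<Longrightarrow> 0 < t \<Longrightarrow> t < T \<Longrightarrow>
       dir_deriv \<Omega> (\<lambda>y. v y t) (\<nu> x) x \<le> (LINT y:\<Omega>|lborel. k x y t * v y t powr l)"
    using \<open>subsolution \<Omega> \<nu> c k p l u0 T v\<close> unfolding subsolution_def D_eq
    by (auto simp: cylinder_def lateral_boundary_def)
  have cont: "continuous_on ?D (\<lambda>(x, t). f x t)" if "C10 \<Omega> T f" for f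
    using that unfolding C10_def Let_def D_eq by blast
  have slice: "continuous_on (closure \<Omega>) (\<lambda>y. f y t)" if "C10 \<Omega> T f" "0 \<le> t" "t < T" for f t
  proof -
    have "continuous_on (closure \<Omega>) (\<lambda>y. (\<lambda>(x, t). f x t) (y, t))"
      by (rule continuous_on_compose2[OF cont[OF that(1)]]) (use that in \<open>auto intro!: continuous_intros\<close>)
    then show ?thesis by simp
  qed
  have bd: "((\<lambda>y. f y t) has_derivative frechet_derivative (\<lambda>y. f y t) (at x within closure \<Omega>))
      (at x within closure \<Omega>)" if "C10 \<Omega> T f" "(x, t) \<in> ?D" for f x t
  proof -
    have "(\<lambda>y. f y t) differentiable (at x within closure \<Omega>)"
      using that unfolding C10_def Let_def D_eq by blast
    then show ?thesis by (simp add: frechet_derivative_works)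
  qed
  have main: "v x t \<le> u x t" if xt: "x \<in> closure \<Omega>" "0 \<le> t" "t < T" for x t
  proof -
    \<comment> \<open>The solutions need not be bounded up to time \<open>T\<close>, so a shorter closed cylinder is used.\<close>
    define S where "S = (t + T) / 2"
    have S: "0 < S" "S < T" "t \<le> S" using xt \<open>T > 0\<close> by (auto simp: S_def)
    let ?K = "closure \<Omega> \<times> {0..S}"
    have cK: "compact ?K" using K by (intro compact_Times) auto
    have KD: "?K \<subseteq> ?D" using S by auto
    note contK = continuous_on_subset[OF cont KD]
    have lips: "\<exists>L\<ge>0. \<forall>y s. y \<in> closure \<Omega> \<longrightarrow> 0 \<le> s \<longrightarrow> s \<le> S \<longrightarrow>
        v y s powr q - u y s powr q \<le> L * max 0 (v y s - u y s)" if q: "q > 0" "min p l \<le> q" for q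
    proof -
      let ?u = "\<lambda>z. case z of (x, t) \<Rightarrow> u x t" and ?v = "\<lambda>z. case z of (x, t) \<Rightarrow> v x t"
      have nonneg: "0 \<le> ?u z" "0 \<le> ?v z" if "z \<in> ?K" for z
        using u(3)[of "fst z" "snd z"] v(3)[of "fst z" "snd z"] subsetD[OF KD that]
        by (simp_all only: prod.collapse case_prod_beta)
      have pos: "(\<forall>z\<in>?K. 0 < ?u z) \<or> (\<forall>z\<in>?K. 0 < ?v z)" if "q < 1"
      proof -
        have "min p l < 1" using q(2) \<open>q < 1\<close> by linarith
        then have "(\<forall>z\<in>?D. 0 < ?u z) \<or> (\<forall>z\<in>?D. 0 < ?v z)"
          using assms(18) unfolding D_eq by (simp only: case_prod_unfold simp_thms)
        then show ?thesis
        proof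
          assume "\<forall>z\<in>?D. 0 < ?u z"
          then show ?thesis using subsetD[OF KD] by (intro disjI1 ballI) (rule bspec)
        next
          assume "\<forall>z\<in>?D. 0 < ?v z"
          then show ?thesis using subsetD[OF KD] by (intro disjI2 ballI) (rule bspec)
        qed
      qed
      obtain L where "0 \<le> L"
          "\<And>z. z \<in> ?K \<Longrightarrow> ?v z powr q - ?u z powr q \<le> L * max 0 (?v z - ?u z)"
        by (rule powr_one_sided_Lipschitz_on_compact[OF cK contK[OF u(2)] contK[OF v(2)] q(1) nonneg pos])
           (assumption+, rule that)
      then show ?thesis by (intro exI[of _ L]) force
    qed
    obtain L1 where L1: "0 \<le> L1" "\<And>y s. y \<in> closure \<Omega> \<Longrightarrow> 0 \<le> s \<Longrightarrow> s \<le> S \<Longrightarrow>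
        v y s powr p - u y s powr p \<le> L1 * max 0 (v y s - u y s)"
      using lips[OF \<open>p > 0\<close>] by auto
    obtain L2 where L2: "0 \<le> L2" "\<And>y s. y \<in> closure \<Omega> \<Longrightarrow> 0 \<le> s \<Longrightarrow> s \<le> S \<Longrightarrow>
        v y s powr l - u y s powr l \<le> L2 * max 0 (v y s - u y s)"
      using lips[OF \<open>l > 0\<close>] by auto
    have "?K \<subseteq> closure \<Omega> \<times> {0..}" by auto
    then obtain C where C: "\<And>z. z \<in> ?K \<Longrightarrow> \<bar>(\<lambda>(x, t). c x t) z\<bar> \<le> C"
      using holder_loc_on_bounded[OF assms(7) cK _ \<open>0 < \<alpha>\<close>] by blast
    have contk: "continuous_on (frontier \<Omega> \<times> closure \<Omega> \<times> {0..S}) (\<lambda>(x, y, t). k x y t)"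
      by (rule continuous_on_subset[OF assms(9)]) auto
    have "compact (frontier \<Omega> \<times> closure \<Omega> \<times> {0..S})"
      using K compact_frontier_bounded[OF \<Omega>(2)] by (intro compact_Times) auto
    from compact_imp_bounded[OF compact_continuous_image[OF contk this]]
    obtain B where B: "\<And>x y s. x \<in> frontier \<Omega> \<Longrightarrow> y \<in> closure \<Omega> \<Longrightarrow> 0 \<le> s \<Longrightarrow> s \<le> S \<Longrightarrow> k x y s \<le> B"
      by (force simp: bounded_iff abs_le_iff)
    have "v x t - u x t \<le> 0"
    proof (rule nonlocal_flux_maximum_principle[where w = "\<lambda>x t. v x t - u x t" and T = S
          and wt = "\<lambda>x t. time_deriv v x t - time_deriv u x t" and \<nu> = \<nu>
          and D = "\<lambda>x t h. frechet_derivative (\<lambda>y. v y t) (at x) h - frechet_derivative (\<lambda>y. u y t) (at x) h"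
          and E = "\<lambda>x t h. frechet_derivative (\<lambda>y. v y t) (at x within closure \<Omega>) h
                        - frechet_derivative (\<lambda>y. u y t) (at x within closure \<Omega>) h"
          and H = "\<lambda>x t b h. frechet_derivative (\<lambda>y. space_deriv b v y t) (at x) h
                        - frechet_derivative (\<lambda>y. space_deriv b u y t) (at x) h"
          and C = "C * L1" and A = "\<bar>B\<bar> * L2 * measure lborel \<Omega>",
          OF \<open>smooth_bounded_domain \<Omega>\<close> _ _ _ _ _ _ _ _ _ xt(1,2) S(3)])
      show "outward_unit_normal \<Omega> x (\<nu> x)" if "x \<in> frontier \<Omega>" for x
        using assms(4) that by blast
      show "continuous_on ?K (\<lambda>(x, t). v x t - u x t)"
        using continuous_on_diff[OF contK[OF v(2)] contK[OF u(2)]] by (simp add: case_prod_beta)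
      show "v x 0 - u x 0 \<le> 0" if "x \<in> closure \<Omega>" for x
        by (rule continuous_le_on_closure[OF _ that])
           (use assms(17) \<open>T > 0\<close> slice[of _ 0] u(2) v(2) in \<open>auto intro!: continuous_on_diff\<close>)
    next
      fix x s assume x: "x \<in> \<Omega>" "0 < s" "s \<le> S"
      then have s: "s < T" using S by simp
      note du = C21_derivatives[OF u(1) x(1,2) s] and dv = C21_derivatives[OF v(1) x(1,2) s]
      show "((\<lambda>t. v x t - u x t) has_real_derivative time_deriv v x s - time_deriv u x s) (at s)"
        by (intro DERIV_diff du dv)
      show "((\<lambda>y. v y s - u y s) has_derivative (\<lambda>h. frechet_derivative (\<lambda>y. v y s) (at x) h
          - frechet_derivative (\<lambda>y. u y s) (at x) h)) (at x)"
        by (intro has_derivative_diff du dv)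
      show "((\<lambda>y. frechet_derivative (\<lambda>y. v y s) (at y) b - frechet_derivative (\<lambda>y. u y s) (at y) b)
          has_derivative (\<lambda>h. frechet_derivative (\<lambda>y. space_deriv b v y s) (at x) h
                        - frechet_derivative (\<lambda>y. space_deriv b u y s) (at x) h)) (at x)"
        if "b \<in> Basis" for b
        by (intro has_derivative_diff du dv that)
      have xc: "x \<in> closure \<Omega>" using x closure_subset by blast
      have c: "0 \<le> c x s" "c x s \<le> C" using assms(8) C[of "(x, s)"] xc x by auto
      have "c x s * (v x s powr p - u x s powr p) \<le> c x s * (L1 * max 0 (v x s - u x s))"
        using L1(2)[OF xc, of s] x c by (intro mult_left_mono) auto
      also have "\<dots> \<le> C * (L1 * max 0 (v x s - u x s))"
        using c L1(1) by (intro mult_right_mono) auto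
      finally have "time_deriv v x s - time_deriv u x s
          \<le> laplacian v x s - laplacian u x s + C * L1 * max 0 (v x s - u x s)"
        using u(4)[OF x(1,2) s] v(4)[OF x(1,2) s] by (simp add: algebra_simps)
      then show "time_deriv v x s - time_deriv u x s \<le>
          (\<Sum>b\<in>Basis. frechet_derivative (\<lambda>y. space_deriv b v y s) (at x) b
                    - frechet_derivative (\<lambda>y. space_deriv b u y s) (at x) b)
          + C * L1 * max 0 (v x s - u x s)"
        by (simp add: laplacian_def space_deriv_def sum_subtractf)
    next
      fix x s assume x: "x \<in> frontier \<Omega>" "0 < s" "s \<le> S"
      have s: "s < T" using x S by simp
      have xD: "(x, s) \<in> ?D" using x s by (auto simp: frontier_def)
      show "((\<lambda>y. v y s - u y s) has_derivative
          (\<lambda>h. frechet_derivative (\<lambda>y. v y s) (at x within closure \<Omega>) h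
             - frechet_derivative (\<lambda>y. u y s) (at x within closure \<Omega>) h)) (at x within closure \<Omega>)"
        by (intro has_derivative_diff bd u v xD)
      fix b :: real assume b: "0 \<le> b" "\<And>y. y \<in> \<Omega> \<Longrightarrow> v y s - u y s \<le> b"
      have int: "set_integrable lborel \<Omega> (\<lambda>y. k x y s * f y s powr l)"
        if f: "C10 \<Omega> T f" "\<And>x t. (x, t) \<in> ?D \<Longrightarrow> 0 \<le> f x t" for f
      proof (rule set_integrable_lborel_continuous_on_closure[OF \<Omega>])
        have "continuous_on (closure \<Omega>) (\<lambda>y. (\<lambda>(x, y, t). k x y t) (x, y, s))"
          by (rule continuous_on_compose2[OF contk]) (use x in \<open>auto intro!: continuous_intros\<close>)
        then have "continuous_on (closure \<Omega>) (\<lambda>y. k x y s)" by simp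
        moreover have "continuous_on (closure \<Omega>) (\<lambda>y. f y s powr l)"
          by (rule continuous_on_powr'[OF slice[OF f(1)] continuous_on_const])
             (use x s f(2) \<open>l > 0\<close> in auto)
        ultimately show "continuous_on (closure \<Omega>) (\<lambda>y. k x y s * f y s powr l)"
          by (rule continuous_on_mult)
      qed
      have "dir_deriv \<Omega> (\<lambda>y. v y s) (\<nu> x) x - dir_deriv \<Omega> (\<lambda>y. u y s) (\<nu> x) x
          \<le> (LINT y:\<Omega>|lborel. k x y s * v y s powr l) - (LINT y:\<Omega>|lborel. k x y s * u y s powr l)"
        using u(5)[OF x(1,2) s] v(5)[OF x(1,2) s] by simp
      also have "\<dots> = (LINT y:\<Omega>|lborel. k x y s * v y s powr l - k x y s * u y s powr l)"
        by (rule set_integral_diff(2)[symmetric]) (intro int u v; assumption)+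
      \<comment> \<open>The kernel is nonnegative, so only the upper bound \<open>b\<close> of the difference counts.\<close>
      also have "\<dots> \<le> (LINT y:\<Omega>|lborel. \<bar>B\<bar> * L2 * b)"
      proof (rule set_integral_mono)
        show "set_integrable lborel \<Omega> (\<lambda>y. k x y s * v y s powr l - k x y s * u y s powr l)"
          by (intro set_integral_diff(1) int u v; assumption)
        show "set_integrable lborel \<Omega> (\<lambda>y. \<bar>B\<bar> * L2 * b)"
          by (rule set_integrable_lborel_continuous_on_closure[OF \<Omega>]) simp
        fix y assume y: "y \<in> \<Omega>"
        then have yc: "y \<in> closure \<Omega>" using closure_subset by blast
        have k: "0 \<le> k x y s" "k x y s \<le> \<bar>B\<bar>"
          using assms(10) B[OF x(1) yc, of s] x yc by auto
        have "k x y s * (v y s powr l - u y s powr l) \<le> k x y s * (L2 * max 0 (v y s - u y s))"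
          using L2(2)[OF yc, of s] x k by (intro mult_left_mono) auto
        also have "\<dots> \<le> \<bar>B\<bar> * (L2 * b)"
          using k L2(1) b(1) b(2)[OF y] by (intro mult_mono) auto
        finally show "k x y s * v y s powr l - k x y s * u y s powr l \<le> \<bar>B\<bar> * L2 * b"
          by (simp add: algebra_simps)
      qed
      also have "\<dots> = \<bar>B\<bar> * L2 * measure lborel \<Omega> * b"
        by (simp add: set_lebesgue_integral_def)
      finally show "frechet_derivative (\<lambda>y. v y s) (at x within closure \<Omega>) (\<nu> x)
          - frechet_derivative (\<lambda>y. u y s) (at x within closure \<Omega>) (\<nu> x)
          \<le> \<bar>B\<bar> * L2 * measure lborel \<Omega> * b"
        by (simp add: dir_deriv_def)
    qed
    then show ?thesis by simp
  qed
  then show ?thesis unfolding D_eq by auto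
qed

end
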